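(* Let $p=(p_0,p_1,\ldots)$ be a critical offspring distribution (mean $1$, $p_1\ne1$), let $\tau$ be a Galton-Watson tree with offspring distribution $p$, and $\tau^{(k)}=(\tau_1,\ldots,\tau_k)$ a forest of $k$ i.i.d. copies of $\tau$. Let $W$ denote the width, and write $\mathbf{P}[W\in\cdot]=\mathbf{P}[W(\tau)\in\cdot]$, $\mathbf{P}^{(k)}[W\in\cdot]=\mathbf{P}[W(\tau^{(k)})\in\cdot]$. Then for every $k\in\mathbb{N}$, $$\lim_{n\to\infty}\frac{\mathbf{P}^{(k)}[W>n]}{\mathbf{P}[W>n]}=k.$$ Assume additionally that $p$ has bounded support. Then for every $k\in\mathbb{N}$, $$\lim_{n\to\infty}\frac{\mathbf{P}^{(k)}[W=n]}{\mathbf{P}[W=n]}=k,$$ where the limit is understood along the infinite sub-sequence $\{n:\mathbf{P}[W=n]>0\}$.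
   Context: $\mathbb{N}=\{1,2,\ldots\}$, $\mathbb{Z}_+=\{0,1,2,\ldots\}$. For a rooted ordered tree $\mathbf{t}$, $Y_h(\mathbf{t})$ is the number of nodes at height (distance from the root) $h$. For a forest $\mathbf{t}^{(k)}=(\mathbf{t}_1,\ldots,\mathbf{t}_k)$ of trees, $Y_h(\mathbf{t}^{(k)})=\sum_{i=1}^kY_h(\mathbf{t}_i)$ and the width is $W(\mathbf{t}^{(k)})=\sup_{h\in\mathbb{Z}_+}Y_h(\mathbf{t}^{(k)})$; in particular $W(\mathbf{t})=\sup_{h\in\mathbb{Z}_+}Y_h(\mathbf{t})$ for a single tree. A Galton-Watson tree with offspring distribution $p$ is a random tree in which the number of children of the root has law $p$ and, conditionally on it being $n$, the $n$ subtrees rooted at these children are independent and distributed as the whole tree. *)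

theory Defs
  imports "HOL-Probability.Probability"
begin

text \<open>
  Rooted ordered trees, finite or infinite but with finitely many children at each node, are coded
  by their sets of Ulam--Harris addresses: the root is the empty word, and the children of \<open>u\<close>
  are, in order, \<open>u @ [0], u @ [1], \<dots>\<close> (numbering starts at 0).
\<close>

type_synonym tree = "nat list set"

definition ordered_tree :: "tree \<Rightarrow> bool" where
  "ordered_tree t \<longleftrightarrow>
     [] \<in> t \<and>
     (\<forall>u i. u @ [i] \<in> t \<longrightarrow> u \<in> t) \<and>
     (\<forall>u\<in>t. \<exists>c. \<forall>i. u @ [i] \<in> t \<longleftrightarrow> i < c)"

definition root_children :: "tree \<Rightarrow> nat" where
  "root_children t = card {i. [i] \<in> t}"

definition subtree :: "nat \<Rightarrow> tree \<Rightarrow> tree" where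
  "subtree i t = {u. i # u \<in> t}"

definition Y :: "nat \<Rightarrow> tree \<Rightarrow> nat" where
  "Y h t = card {u \<in> t. length u = h}"

definition Y_forest :: "nat \<Rightarrow> tree list \<Rightarrow> nat" where
  "Y_forest h ts = (\<Sum>t\<leftarrow>ts. Y h t)"

text \<open>The width is extended-valued because infinite trees are allowed.\<close>

definition width :: "tree list \<Rightarrow> enat" where
  "width ts = (SUP h. enat (Y_forest h ts))"

definition tree_space :: "tree measure" where
  "tree_space = sigma {t. ordered_tree t} (range (\<lambda>u. {t. ordered_tree t \<and> u \<in> t}))"

text \<open>The Bochner integral of a non-integrable function is 0, so mean 1 includes integrability.\<close>

definition critical :: "nat pmf \<Rightarrow> bool" where
  "critical p \<longleftrightarrow> measure_pmf.expectation p real = 1 \<and> pmf p 1 \<noteq> 1"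

text \<open>
  The last conjunct states jointly that, given \<open>n\<close> children of the root, the \<open>n\<close> subtrees are
  independent and each is distributed as the whole tree.
\<close>

definition galton_watson :: "'a measure \<Rightarrow> nat pmf \<Rightarrow> ('a \<Rightarrow> tree) \<Rightarrow> bool" where
  "galton_watson M p \<tau> \<longleftrightarrow>
     prob_space M \<and>
     \<tau> \<in> measurable M tree_space \<and>
     (\<forall>n. \<P>(\<omega> in M. root_children (\<tau> \<omega>) = n) = pmf p n) \<and>
     (\<forall>n A. pmf p n > 0 \<longrightarrow> (\<forall>i<n. A i \<in> sets tree_space) \<longrightarrow>
        \<P>(\<omega> in M. (\<forall>i<n. subtree i (\<tau> \<omega>) \<in> A i) \<bar> root_children (\<tau> \<omega>) = n)
          = (\<Prod>i<n. \<P>(\<omega> in M. \<tau> \<omega> \<in> A i)))"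

definition galton_watson_forest ::
    "'a measure \<Rightarrow> nat pmf \<Rightarrow> nat \<Rightarrow> (nat \<Rightarrow> 'a \<Rightarrow> tree) \<Rightarrow> bool" where
  "galton_watson_forest M p k \<sigma> \<longleftrightarrow>
     prob_space M \<and>
     (\<forall>i<k. galton_watson M p (\<sigma> i)) \<and>
     prob_space.indep_vars M (\<lambda>_. tree_space) \<sigma> {..<k}"

definition forest :: "nat \<Rightarrow> (nat \<Rightarrow> 'a \<Rightarrow> tree) \<Rightarrow> 'a \<Rightarrow> tree list" where
  "forest k \<sigma> \<omega> = map (\<lambda>i. \<sigma> i \<omega>) [0..<k]"

end

theory Submission
  imports Defs
begin

text \<open>
  Write \<open>u\<^sub>K(n)\<close> for the probability that a forest of \<open>K\<close> independent trees has width at most \<open>n\<close>,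
  and \<open>r\<^sub>K(n) = 1 - u\<^sub>K(n)\<close>. Conditioning a forest of \<open>K\<close> trees on the size \<open>Z\<^sub>K\<close> of its next
  generation (a sum of \<open>K\<close> independent offspring numbers, so of mean \<open>K\<close>) gives
  \<open>r\<^sub>K(n) = E r(Z\<^sub>K)(n)\<close> as soon as \<open>n \<ge> K\<close>. For the ratios \<open>\<rho>\<^sub>K(n) = r\<^sub>K(n) / r\<^sub>1(n)\<close> this reads
  \<open>\<rho>\<^sub>K = E \<rho>(Z\<^sub>K)\<close>. Two trees of which one is wide form a wide forest, and \<open>r\<^sub>1(n) \<longlonglongrightarrow> 0\<close>, so
  \<open>\<rho>\<^sub>K\<^sub>+\<^sub>1(n) \<ge> (1 - o(1)) \<rho>\<^sub>K(n) + 1\<close>, whence \<open>liminf \<rho>\<^sub>K \<ge> K\<close> for every \<open>K\<close>.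

  These lower bounds are forced to be sharp by a Fatou argument. If \<open>\<rho>\<^sub>K \<longlonglongrightarrow> K\<close>, then
  \<open>E \<rho>(Z\<^sub>K) \<longlonglongrightarrow> K = E Z\<^sub>K\<close>, which leaves no room for \<open>limsup \<rho>\<^sub>j > j\<close> at any \<open>j\<close> in the support of
  \<open>Z\<^sub>K\<close>. Starting from \<open>K = 1\<close> and using an offspring number \<open>d \<ge> 2\<close> of positive probability, one gets
  \<open>\<rho>\<^sub>K \<longlonglongrightarrow> K\<close> for \<open>K = 1, d, d\<^sup>2, \<dots>\<close>; the recursive lower bound carries the limit from \<open>K + 1\<close> down to \<open>K\<close>.
  This is \<open>ratio_tendsto\<close>, which is stated for an arbitrary family \<open>\<rho>\<close> and an arbitrary filter.

  The bound \<open>r\<^sub>1(n) \<le> 1 / (n + 1)\<close> is the maximal inequality for the generation sizes, which form a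
  nonnegative martingale of mean 1; it also shows that the width is almost surely finite.

  For \<open>s\<^sub>K(n) = u\<^sub>K(n) - u\<^sub>K(n - 1)\<close>, the probability of width exactly \<open>n\<close>, the same scheme applies along
  \<open>{n. s\<^sub>1(n) > 0}\<close>. The recursive lower bound now comes from extinction: if the support of \<open>p\<close> is bounded,
  then generations up to a fixed height \<open>h\<close> are too small to matter for large \<open>n\<close>, so a forest has width
  \<open>n\<close> if one part has width \<open>n\<close> and the other part is extinct by height \<open>h\<close>; the two ways for this to
  happen are disjoint, and the extinction probabilities tend to 1 as \<open>h\<close> grows
  (\<open>width_eq_prob_superadditive\<close>, \<open>extinct_prob_tendsto_1\<close>).

  All this takes place in an explicit model of the law of the generation sizes. The last part identifies
  that law with the law of the generation sizes of Galton--Watson trees and forests.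
\<close>

section \<open>Generation sizes as a branching process\<close>

text \<open>
  The law of the number of children of \<open>K\<close> individuals that reproduce independently according to \<open>p\<close>.
\<close>

fun total_offspring :: "nat pmf \<Rightarrow> nat \<Rightarrow> nat pmf" where
  "total_offspring p 0 = return_pmf 0"
| "total_offspring p (Suc K) = map_pmf (\<lambda>(i, j). i + j) (pair_pmf p (total_offspring p K))"

text \<open>
  The law of the list \<open>[Y\<^sub>0, \<dots>, Y\<^sub>h]\<close> of generation sizes up to height \<open>h\<close> (hence of length \<open>h + 1\<close>) of
  a population started from \<open>K\<close> individuals, as a Markov chain.
\<close>

fun gen_sizes :: "nat pmf \<Rightarrow> nat \<Rightarrow> nat \<Rightarrow> nat list pmf" where
  "gen_sizes p 0 K = return_pmf [K]"
| "gen_sizes p (Suc h) K =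
     bind_pmf (total_offspring p K) (\<lambda>j. map_pmf (Cons K) (gen_sizes p h j))"

lemma prob_bind_pmf:
  "measure_pmf.prob (bind_pmf \<mu> f) A = measure_pmf.expectation \<mu> (\<lambda>x. measure_pmf.prob (f x) A)"
proof -
  have "ennreal (measure_pmf.prob (bind_pmf \<mu> f) A) =
        (\<integral>\<^sup>+x. ennreal (measure_pmf.prob (f x) A) \<partial>\<mu>)"
    by (simp flip: measure_pmf.emeasure_eq_measure)
  also have "\<dots> = ennreal (measure_pmf.expectation \<mu> (\<lambda>x. measure_pmf.prob (f x) A))"
    by (intro nn_integral_eq_integral measure_pmf.integrable_const_bound[where B = 1]) auto
  finally show ?thesis
    by (simp add: integral_nonneg_AE)
qed

lemma total_offspring_add:
  "total_offspring p (K + L) =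
     map_pmf (\<lambda>(i, j). i + j) (pair_pmf (total_offspring p K) (total_offspring p L))"
proof (induction K)
  case 0
  then show ?case by (simp add: pair_return_pmf1 pmf.map_comp o_def)
next
  case (Suc K)
  then show ?case
    by (simp add: pair_pmf_def map_pmf_def bind_assoc_pmf bind_return_pmf add.assoc)
qed

lemma total_offspring_1 [simp]: "total_offspring p (Suc 0) = p"
  by (simp add: pair_return_pmf2 pmf.map_comp o_def)

lemma integrable_expectation_total_offspring:
  assumes int: "integrable (measure_pmf p) real" and mean: "measure_pmf.expectation p real = 1"
  shows "integrable (measure_pmf (total_offspring p K)) real \<and>
         measure_pmf.expectation (total_offspring p K) real = real K"
proof (induction K)
  case (Suc K)
  let ?q = "pair_pmf p (total_offspring p K)"
  have 1: "integrable (measure_pmf ?q) (\<lambda>x. real (fst x))"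
    using int integrable_map_pmf_eq[of fst ?q real] by (simp add: map_fst_pair_pmf)
  have 2: "integrable (measure_pmf ?q) (\<lambda>x. real (snd x))"
    using Suc integrable_map_pmf_eq[of snd ?q real] by (simp add: map_snd_pair_pmf)
  have "integrable (measure_pmf ?q) (\<lambda>x. real (fst x) + real (snd x))"
    using 1 2 by simp
  moreover have "measure_pmf.expectation ?q (\<lambda>x. real (fst x) + real (snd x)) = 1 + real K"
    using 1 2 Suc mean by simp
  ultimately show ?case
    by (simp add: integrable_map_pmf_eq case_prod_unfold)
qed (simp add: integrable_measure_pmf_finite)

lemma mult_mem_total_offspring: "d \<in> set_pmf p \<Longrightarrow> K * d \<in> set_pmf (total_offspring p K)"
  by (induction K) (auto simp: image_iff)

lemma total_offspring_le:
  assumes "\<And>j. j \<in> set_pmf p \<Longrightarrow> j \<le> D"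
  shows "j \<in> set_pmf (total_offspring p K) \<Longrightarrow> j \<le> K * D"
proof (induction K arbitrary: j)
  case (Suc K)
  then show ?case using assms by (fastforce intro: add_mono)
qed simp

lemma length_gen_sizes: "x \<in> set_pmf (gen_sizes p h K) \<Longrightarrow> length x = Suc h"
  by (induction h arbitrary: K x) auto

text \<open>
  The branching property: disjoint groups of ancestors have independent descendants.
\<close>

lemma gen_sizes_add:
  "gen_sizes p h (K + L) =
     map_pmf (\<lambda>(x, y). map2 (+) x y) (pair_pmf (gen_sizes p h K) (gen_sizes p h L))"
proof (induction h arbitrary: K L)
  case (Suc h)
  show ?case
    unfolding gen_sizes.simps total_offspring_add
    unfolding pair_pmf_def map_pmf_def bind_assoc_pmf bind_return_pmf split
    by (simp add: Suc pair_pmf_def map_pmf_def bind_assoc_pmf bind_return_pmf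
         bind_commute_pmf[of "gen_sizes p h _" "total_offspring p L"])
qed (simp add: pair_return_pmf1)

lemma gen_sizes_0 [simp]: "gen_sizes p h 0 = return_pmf (replicate (Suc h) 0)"
  by (induction h) (auto simp: bind_return_pmf)

lemma prob_gen_sizes_add:
  "measure_pmf.prob (gen_sizes p h (K + L)) A =
     measure_pmf.prob (pair_pmf (gen_sizes p h K) (gen_sizes p h L)) {(x, y). map2 (+) x y \<in> A}"
  unfolding gen_sizes_add by (simp add: vimage_def case_prod_unfold)

lemma prob_gen_sizes_Suc:
  "measure_pmf.prob (gen_sizes p (Suc h) K) A =
     measure_pmf.expectation (total_offspring p K)
       (\<lambda>j. measure_pmf.prob (gen_sizes p h j) {x. K # x \<in> A})"
  by (simp add: prob_bind_pmf vimage_def)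

section \<open>Convergence of ratios\<close>

text \<open>
  A converse to Fatou's lemma on \<open>\<nat>\<close>: if \<open>liminf \<rho>\<^sub>j \<ge> j\<close> for every \<open>j\<close> and the \<open>\<mu>\<close>-expectations of \<open>\<rho>\<close>
  converge to the mean of \<open>\<mu>\<close>, then no atom of \<open>\<mu>\<close> can carry an excess.
\<close>

lemma tendsto_of_expectation_tendsto:
  fixes \<mu> :: "nat pmf" and \<rho> :: "nat \<Rightarrow> 'c \<Rightarrow> real"
  assumes int: "integrable (measure_pmf \<mu>) real"
    and nonneg: "\<forall>\<^sub>F n in F. \<forall>j. 0 \<le> \<rho> j n"
    and int\<rho>: "\<forall>\<^sub>F n in F. integrable (measure_pmf \<mu>) (\<lambda>j. \<rho> j n)"
    and lower: "\<And>j \<epsilon>. \<epsilon> > 0 \<Longrightarrow> \<forall>\<^sub>F n in F. real j - \<epsilon> \<le> \<rho> j n"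
    and lim: "((\<lambda>n. measure_pmf.expectation \<mu> (\<lambda>j. \<rho> j n)) \<longlongrightarrow> measure_pmf.expectation \<mu> real) F"
    and k: "k \<in> set_pmf \<mu>"
  shows "(\<rho> k \<longlongrightarrow> real k) F"
proof (rule tendstoI)
  fix \<epsilon> :: real
  assume \<epsilon>: "\<epsilon> > 0"
  define m where "m = measure_pmf.expectation \<mu> real"
  define \<delta> where "\<delta> = \<epsilon> * pmf \<mu> k / 4"
  have pk: "pmf \<mu> k > 0"
    using k by (simp add: pmf_positive)
  have \<delta>: "\<delta> > 0"
    using \<epsilon> pk by (simp add: \<delta>_def)
  have "(\<lambda>N. measure_pmf.expectation \<mu> (\<lambda>j. real j * indicator {..<N} j)) \<longlonglongrightarrow> m"
    unfolding m_def
  proof (rule integral_dominated_convergence[where w = real])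
    show "AE j in \<mu>. (\<lambda>N. real j * indicator {..<N} j) \<longlonglongrightarrow> real j"
    proof (rule AE_I2)
      fix j :: nat
      have "\<forall>\<^sub>F N in sequentially. real j * indicator {..<N} j = real j"
        using eventually_gt_at_top[of j] by eventually_elim auto
      then show "(\<lambda>N. real j * indicator {..<N} j) \<longlonglongrightarrow> real j"
        by (rule tendsto_eventually)
    qed
  qed (use int in \<open>auto split: split_indicator\<close>)
  then have "\<forall>\<^sub>F N in sequentially. m - \<delta> < measure_pmf.expectation \<mu> (\<lambda>j. real j * indicator {..<N} j)"
    using \<delta> by (intro order_tendstoD) auto
  \<comment> \<open>The mean of \<open>\<mu>\<close> up to \<open>\<delta>\<close> is carried by \<open>{..<N}\<close>.\<close>
  then obtain N where N: "m - \<delta> < measure_pmf.expectation \<mu> (\<lambda>j. real j * indicator {..<N} j)"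
    using eventually_happens'[OF sequentially_bot] by blast
  have "\<forall>\<^sub>F n in F. \<forall>j<N. real j - \<delta> \<le> \<rho> j n"
    using lower[OF \<delta>] by (simp add: eventually_ball_finite_distrib flip: Ball_def lessThan_iff)
  moreover have "\<forall>\<^sub>F n in F. measure_pmf.expectation \<mu> (\<lambda>j. \<rho> j n) < m + \<delta>"
    using lim \<delta> by (intro order_tendstoD) (auto simp: m_def)
  moreover have "\<forall>\<^sub>F n in F. real k - \<epsilon> / 2 \<le> \<rho> k n"
    using \<epsilon> by (intro lower) auto
  ultimately show "\<forall>\<^sub>F n in F. dist (\<rho> k n) (real k) < \<epsilon>"
    using nonneg int\<rho>
  proof eventually_elim
    case (elim n)
    \<comment> \<open>Compare with the lower bounds below \<open>N\<close>, keeping the exact value at \<open>k\<close>.\<close>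
    have "measure_pmf.expectation \<mu> (\<lambda>j. real j * indicator {..<N} j - \<delta> + (\<rho> k n - real k) * indicator {k} j)
            \<le> measure_pmf.expectation \<mu> (\<lambda>j. \<rho> j n)"
    proof (rule integral_mono)
      show "integrable \<mu> (\<lambda>j. real j * indicator {..<N} j - \<delta> + (\<rho> k n - real k) * indicator {k} j)"
        using int
        by (intro Bochner_Integration.integrable_add Bochner_Integration.integrable_diff
            integrable_real_mult_indicator) auto
      fix j
      show "real j * indicator {..<N} j - \<delta> + (\<rho> k n - real k) * indicator {k} j \<le> \<rho> j n"
        using elim \<delta> by (auto split: split_indicator simp: algebra_simps intro: order_trans)
    qed (use elim in auto)
    also have "measure_pmf.expectation \<mu> (\<lambda>j. real j * indicator {..<N} j - \<delta> + (\<rho> k n - real k) * indicator {k} j)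
      = measure_pmf.expectation \<mu> (\<lambda>j. real j * indicator {..<N} j) - \<delta> + (\<rho> k n - real k) * pmf \<mu> k"
    proof -
      have 1: "integrable \<mu> (\<lambda>j. real j * indicator {..<N} j)"
        using int by (intro integrable_real_mult_indicator) auto
      have 2: "integrable \<mu> (indicator {k} :: nat \<Rightarrow> real)"
        by (simp add: measure_pmf.integrable_const_bound[where B = 1])
      show ?thesis
        using 1 2 by (simp add: measure_pmf_single)
    qed
    finally have "(\<rho> k n - real k) * pmf \<mu> k < 3 * \<delta>"
      using elim N by linarith
    also have "\<dots> < \<epsilon> * pmf \<mu> k"
      using \<epsilon> pk by (simp add: \<delta>_def)
    finally have "\<rho> k n - real k < \<epsilon>"
      using pk by simp
    then show ?case
      using elim \<epsilon> by (auto simp: dist_real_def)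
  qed
qed

lemma criticalD:
  assumes "critical p"
  shows "integrable (measure_pmf p) real" "measure_pmf.expectation p real = 1"
    "\<exists>d\<ge>2. d \<in> set_pmf p"
proof -
  show mean: "measure_pmf.expectation p real = 1"
    using assms by (simp add: critical_def)
  show int: "integrable (measure_pmf p) real"
    using mean not_integrable_integral_eq by fastforce
  show "\<exists>d\<ge>2. d \<in> set_pmf p"
  proof (rule ccontr)
    assume "\<not> ?thesis"
    then have le: "j \<le> 1" if "j \<in> set_pmf p" for j
      using that by (metis not_less_eq_eq numeral_2_eq_2 One_nat_def)
    have "measure_pmf.expectation p real = measure_pmf.expectation p (indicator {1})"
      using le by (intro integral_cong_AE) (auto simp: AE_measure_pmf_iff le_Suc_eq split: split_indicator)
    then have "pmf p 1 = 1"
      using mean by (simp add: measure_pmf_single)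
    then show False
      using assms by (simp add: critical_def)
  qed
qed

text \<open>
  The core of the argument. The functions \<open>\<rho>\<^sub>K\<close> stand for ratios of the probability of a rare event for
  \<open>K\<close> trees to its probability for one tree; \<open>step\<close> is the decomposition at the first generation, and
  \<open>super\<close> is the recursive lower bound.
\<close>

lemma ratio_tendsto:
  fixes \<rho> :: "nat \<Rightarrow> 'c \<Rightarrow> real"
  assumes crit: "critical p"
    and nonneg: "\<forall>\<^sub>F n in F. \<forall>j. 0 \<le> \<rho> j n"
    and int: "\<And>K. \<forall>\<^sub>F n in F. integrable (measure_pmf (total_offspring p K)) (\<lambda>j. \<rho> j n)"
    and step: "\<And>K. K \<ge> 1 \<Longrightarrow> \<forall>\<^sub>F n in F. measure_pmf.expectation (total_offspring p K) (\<lambda>j. \<rho> j n) = \<rho> K n"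
    and one: "\<forall>\<^sub>F n in F. \<rho> 1 n = 1"
    and super: "\<And>K \<epsilon>. 0 < \<epsilon> \<Longrightarrow> \<epsilon> < 1 \<Longrightarrow> \<forall>\<^sub>F n in F. (1 - \<epsilon>) * \<rho> K n + (1 - \<epsilon>) \<le> \<rho> (Suc K) n"
  shows "(\<rho> K \<longlongrightarrow> real K) F"
proof -
  have lower: "\<forall>\<^sub>F n in F. real j - \<epsilon> \<le> \<rho> j n" if "\<epsilon> > 0" for j \<epsilon>
    using that
  proof (induction j arbitrary: \<epsilon>)
    case 0
    from nonneg show ?case
      by eventually_elim (use 0 in \<open>auto intro: order_trans[of _ 0]\<close>)
  next
    case (Suc j)
    define \<delta> where "\<delta> = min (1/2) (\<epsilon> / (2 * real (Suc j)))"
    have \<delta>: "0 < \<delta>" "\<delta> < 1"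
      using Suc.prems by (auto simp: \<delta>_def)
    have "\<delta> \<le> \<epsilon> / (2 * real (Suc j))"
      by (simp add: \<delta>_def)
    then have \<delta>': "\<delta> * real (Suc j) \<le> \<epsilon> / 2"
      by (simp add: pos_le_divide_eq algebra_simps)
    have "\<epsilon> / 2 > 0" using Suc.prems by simp
    from Suc.IH[OF this] super[OF \<delta>(1,2), of j] nonneg show ?case
    proof eventually_elim
      case (elim n)
      have "(1 - \<delta>) * (real j - \<epsilon> / 2) \<le> (1 - \<delta>) * \<rho> j n"
        using elim \<delta> by (intro mult_left_mono) auto
      moreover have "\<delta> * (\<epsilon> / 2) \<ge> 0"
        using \<delta> Suc.prems by simp
      moreover have "(1 - \<delta>) * (real j - \<epsilon> / 2) + (1 - \<delta>)
          = real (Suc j) - \<epsilon> / 2 - \<delta> * real (Suc j) + \<delta> * (\<epsilon> / 2)"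
        by (simp add: field_simps)
      ultimately show ?case
        using elim(2) \<delta>' by linarith
    qed
  qed
  define good where "good K \<longleftrightarrow> (\<rho> K \<longlongrightarrow> real K) F" for K
  have up: "good j" if "good K" "K \<ge> 1" "j \<in> set_pmf (total_offspring p K)" for K j
    unfolding good_def
  proof (rule tendsto_of_expectation_tendsto[OF _ nonneg int lower _ that(3)])
    note E = integrable_expectation_total_offspring[OF criticalD(1,2)[OF crit], of K]
    show "integrable (total_offspring p K) real"
      using E by simp
    have "((\<lambda>n. measure_pmf.expectation (total_offspring p K) (\<lambda>j. \<rho> j n)) \<longlongrightarrow> real K) F"
      using that(1) step[OF that(2)] unfolding good_def by (simp cong: tendsto_cong)
    then show "((\<lambda>n. measure_pmf.expectation (total_offspring p K) (\<lambda>j. \<rho> j n))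
      \<longlongrightarrow> measure_pmf.expectation (total_offspring p K) real) F"
      using E by simp
  qed
  obtain d where d: "d \<ge> 2" "d \<in> set_pmf p"
    using criticalD(3)[OF crit] by blast
  have pow: "good (d ^ i)" for i
  proof (induction i)
    case 0
    show ?case using one by (simp add: good_def tendsto_eventually)
  next
    case (Suc i)
    have "d ^ i * d \<in> set_pmf (total_offspring p (d ^ i))"
      using d by (intro mult_mem_total_offspring)
    moreover have "d ^ i \<ge> 1"
      using d by simp
    ultimately have "good (d ^ i * d)"
      using Suc up by blast
    then show ?case
      by (simp only: power_Suc2)
  qed
  have down: "good K" if "good (Suc K)" for K
    unfolding good_def
  proof (rule tendstoI)
    fix \<epsilon> :: real
    assume \<epsilon>: "\<epsilon> > 0"
    define \<delta> where "\<delta> = min (1/2) (\<epsilon> / (2 * (real K + \<epsilon> + 2)))"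
    have \<delta>: "0 < \<delta>" "\<delta> < 1"
      using \<epsilon> by (auto simp: \<delta>_def)
    have "\<delta> \<le> \<epsilon> / (2 * (real K + \<epsilon> + 2))"
      by (simp add: \<delta>_def)
    then have \<delta>': "\<delta> * (real K + \<epsilon> + 2) \<le> \<epsilon> / 2"
      using \<epsilon> by (simp add: pos_le_divide_eq algebra_simps)
    have "\<forall>\<^sub>F n in F. \<rho> (Suc K) n < real (Suc K) + \<delta>"
      using that \<delta> unfolding good_def by (intro order_tendstoD) auto
    moreover have "\<forall>\<^sub>F n in F. real K - \<epsilon> / 2 \<le> \<rho> K n"
      using lower[of "\<epsilon> / 2"] \<epsilon> by simp
    ultimately show "\<forall>\<^sub>F n in F. dist (\<rho> K n) (real K) < \<epsilon>"
      using super[OF \<delta>(1,2), of K]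
    proof eventually_elim
      case (elim n)
      have "(1 - \<delta>) * \<rho> K n < real K + 2 * \<delta>"
        using elim by simp
      also have "\<dots> \<le> (1 - \<delta>) * (real K + \<epsilon>) - \<epsilon> / 2"
        using \<delta>' by (simp add: algebra_simps)
      also have "\<dots> < (1 - \<delta>) * (real K + \<epsilon>)"
        using \<epsilon> by simp
      finally have "\<rho> K n < real K + \<epsilon>"
        using \<delta> by simp
      then show ?case
        using elim \<epsilon> by (auto simp: dist_real_def)
    qed
  qed
  have "K \<le> d ^ K"
    using d by (metis less_imp_le order_less_le_trans less_exp power_mono zero_le)
  then have "good K"
  proof (induction rule: inc_induct)
    case base
    then show ?case by (rule pow)
  next
    case (step n)
    show ?case by (rule down) (rule step.IH)
  qed
  then show ?thesis
    by (simp add: good_def)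
qed

section \<open>The tail of the width\<close>

lemma integrable_pmf_bounded:
  fixes f :: "'a \<Rightarrow> real"
  assumes "\<And>x. \<bar>f x\<bar> \<le> B"
  shows "integrable (measure_pmf \<mu>) f"
  using assms by (intro measure_pmf.integrable_const_bound[where B = B]) auto

lemma tendsto_expectation_pmf:
  fixes f :: "nat \<Rightarrow> 'a \<Rightarrow> real"
  assumes "\<And>h x. \<bar>f h x\<bar> \<le> B" "\<And>x. (\<lambda>h. f h x) \<longlonglongrightarrow> g x"
  shows "(\<lambda>h. measure_pmf.expectation \<mu> (f h)) \<longlonglongrightarrow> measure_pmf.expectation \<mu> g"
  by (rule integral_dominated_convergence[where w = "\<lambda>_. B"]) (use assms in auto)

text \<open>
  The probability that none of the generations \<open>0, \<dots>, h\<close> of \<open>K\<close> ancestors has more than \<open>n\<close> members.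
\<close>

definition max_le_prob :: "nat pmf \<Rightarrow> nat \<Rightarrow> nat \<Rightarrow> nat \<Rightarrow> real" where
  "max_le_prob p n h K = measure_pmf.prob (gen_sizes p h K) {x. \<forall>y\<in>set x. y \<le> n}"

text \<open>
  The limit as \<open>h\<close> grows: the probability that the width of a forest of \<open>K\<close> trees is at most \<open>n\<close>.
\<close>

definition width_le_prob :: "nat pmf \<Rightarrow> nat \<Rightarrow> nat \<Rightarrow> real" where
  "width_le_prob p n K = lim (\<lambda>h. max_le_prob p n h K)"

lemma max_le_prob_bounds: "0 \<le> max_le_prob p n h K" "max_le_prob p n h K \<le> 1"
  by (auto simp: max_le_prob_def)

lemma max_le_prob_0: "max_le_prob p n 0 K = of_bool (K \<le> n)"
  by (auto simp: max_le_prob_def)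

lemma max_le_prob_Suc:
  "max_le_prob p n (Suc h) K =
     of_bool (K \<le> n) * measure_pmf.expectation (total_offspring p K) (max_le_prob p n h)"
  unfolding max_le_prob_def prob_gen_sizes_Suc by (cases "K \<le> n") auto

lemma max_le_prob_mono: "n \<le> m \<Longrightarrow> max_le_prob p n h K \<le> max_le_prob p m h K"
  unfolding max_le_prob_def by (intro measure_pmf.finite_measure_mono) auto

lemma max_le_prob_decreasing: "max_le_prob p n (Suc h) K \<le> max_le_prob p n h K"
proof (induction h arbitrary: K)
  case 0
  have "measure_pmf.expectation (total_offspring p K) (max_le_prob p n 0) \<le> 1"
    by (rule measure_pmf.integral_le_const)
      (auto intro!: integrable_pmf_bounded[where B = 1] simp: max_le_prob_bounds)
  then show ?case
    by (auto simp: max_le_prob_Suc max_le_prob_0[of p n K])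
next
  case (Suc h)
  have "measure_pmf.expectation (total_offspring p K) (max_le_prob p n (Suc h))
      \<le> measure_pmf.expectation (total_offspring p K) (max_le_prob p n h)"
    using Suc by (intro integral_mono integrable_pmf_bounded[where B = 1]) (auto simp: max_le_prob_bounds)
  then show ?case
    by (simp add: max_le_prob_Suc[of p n "Suc h"] max_le_prob_Suc[of p n h])
qed

lemma tendsto_width_le_prob: "(\<lambda>h. max_le_prob p n h K) \<longlonglongrightarrow> width_le_prob p n K"
proof -
  have "decseq (\<lambda>h. max_le_prob p n h K)"
    by (intro decseq_SucI max_le_prob_decreasing)
  then have "convergent (\<lambda>h. max_le_prob p n h K)"
    using max_le_prob_bounds(1) by (metis convergentI decseq_convergent)
  then show ?thesis
    by (simp add: width_le_prob_def convergent_LIMSEQ_iff)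
qed

lemma width_le_prob_bounds: "0 \<le> width_le_prob p n K" "width_le_prob p n K \<le> 1"
  by (rule LIMSEQ_le_const[OF tendsto_width_le_prob], simp add: max_le_prob_bounds)
    (rule LIMSEQ_le_const2[OF tendsto_width_le_prob], simp add: max_le_prob_bounds)

lemma width_le_prob_mono: "n \<le> m \<Longrightarrow> width_le_prob p n K \<le> width_le_prob p m K"
  by (rule LIMSEQ_le[OF tendsto_width_le_prob tendsto_width_le_prob])
    (auto intro: max_le_prob_mono)

lemma width_le_prob_step:
  "width_le_prob p n K =
     of_bool (K \<le> n) * measure_pmf.expectation (total_offspring p K) (width_le_prob p n)"
proof (rule LIMSEQ_unique)
  show "(\<lambda>h. max_le_prob p n (Suc h) K) \<longlonglongrightarrow> width_le_prob p n K"
    using tendsto_width_le_prob by (rule LIMSEQ_Suc)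
  show "(\<lambda>h. max_le_prob p n (Suc h) K) \<longlonglongrightarrow>
      of_bool (K \<le> n) * measure_pmf.expectation (total_offspring p K) (width_le_prob p n)"
    unfolding max_le_prob_Suc
    by (intro tendsto_mult_left tendsto_expectation_pmf[where B = 1] tendsto_width_le_prob)
      (simp add: max_le_prob_bounds)
qed

lemma prob_pair_pmf_Times:
  fixes \<mu> :: "'a::countable pmf" and \<nu> :: "'b::countable pmf"
  shows "measure_pmf.prob (pair_pmf \<mu> \<nu>) (A \<times> B) = measure_pmf.prob \<mu> A * measure_pmf.prob \<nu> B"
  by (rule measure_pmf_prob_product) auto

text \<open>
  If the sum of two populations never exceeds \<open>n\<close>, then the same holds for each of the two.
\<close>

lemma max_le_prob_add_le: "max_le_prob p n h (K + L) \<le> max_le_prob p n h K * max_le_prob p n h L"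
proof -
  have "max_le_prob p n h (K + L) \<le> measure_pmf.prob (pair_pmf (gen_sizes p h K) (gen_sizes p h L))
     ({x. \<forall>y\<in>set x. y \<le> n} \<times> {x. \<forall>y\<in>set x. y \<le> n})"
    unfolding max_le_prob_def prob_gen_sizes_add
  proof (rule measure_pmf.finite_measure_mono_AE, rule AE_pmfI)
    fix z
    assume "z \<in> set_pmf (pair_pmf (gen_sizes p h K) (gen_sizes p h L))"
    then obtain x y where z: "z = (x, y)" and len: "length x = Suc h" "length y = Suc h"
      by (auto dest: length_gen_sizes)
    show "z \<in> {(x, y). map2 (+) x y \<in> {x. \<forall>y\<in>set x. y \<le> n}} \<longrightarrow>
        z \<in> {x. \<forall>y\<in>set x. y \<le> n} \<times> {x. \<forall>y\<in>set x. y \<le> n}"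
    proof
      assume "z \<in> {(x, y). map2 (+) x y \<in> {x. \<forall>y\<in>set x. y \<le> n}}"
      then have "x ! i + y ! i \<le> n" if "i < Suc h" for i
        using that len by (auto simp: z all_set_conv_all_nth)
      then have "x ! i \<le> n \<and> y ! i \<le> n" if "i < Suc h" for i
        using that by (meson add_leE)
      then show "z \<in> {x. \<forall>y\<in>set x. y \<le> n} \<times> {x. \<forall>y\<in>set x. y \<le> n}"
        using len by (auto simp: z all_set_conv_all_nth)
    qed
  qed auto
  then show ?thesis
    by (simp add: prob_pair_pmf_Times max_le_prob_def)
qed

lemma width_le_prob_add_le: "width_le_prob p n (K + L) \<le> width_le_prob p n K * width_le_prob p n L"
  by (rule LIMSEQ_le[OF tendsto_width_le_prob tendsto_mult[OF tendsto_width_le_prob tendsto_width_le_prob]])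
    (auto intro: max_le_prob_add_le)

text \<open>
  The maximal inequality for the martingale of generation sizes, by induction on the height.
\<close>

lemma width_gt_prob_le:
  assumes "critical p"
  shows "1 - width_le_prob p n K \<le> real K / (real n + 1)"
proof -
  have "1 - max_le_prob p n h K \<le> real K / (real n + 1)" for h
  proof (induction h arbitrary: K)
    case 0
    then show ?case by (auto simp: max_le_prob_0 field_simps)
  next
    case (Suc h)
    note E = integrable_expectation_total_offspring[OF criticalD(1,2)[OF assms], of K]
    note int = integrable_pmf_bounded[of "max_le_prob p n h" 1 "total_offspring p K"]
    show ?case
    proof (cases "K \<le> n")
      case True
      have "measure_pmf.expectation (total_offspring p K) (\<lambda>j. 1 - max_le_prob p n h j)
          \<le> measure_pmf.expectation (total_offspring p K) (\<lambda>j. real j / (real n + 1))"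
        using E Suc int by (intro integral_mono) (auto simp: max_le_prob_bounds)
      then show ?thesis
        using True E int by (simp add: max_le_prob_Suc max_le_prob_bounds)
    qed (auto simp: max_le_prob_Suc field_simps)
  qed
  then show ?thesis
    by (intro LIMSEQ_le_const2[OF tendsto_diff[OF tendsto_const tendsto_width_le_prob]]) auto
qed

text \<open>
  With an offspring number \<open>d \<ge> 2\<close> of positive probability, the population can be multiplied by \<open>d\<close>
  until it exceeds \<open>n\<close>.
\<close>

lemma width_le_prob_less_1:
  assumes "critical p" "K \<ge> 1"
  shows "width_le_prob p n K < 1"
  using assms(2)
proof (induction "Suc n - K" arbitrary: K rule: less_induct)
  case less
  show ?case
  proof (cases "K \<le> n")
    case True
    obtain d where d: "d \<ge> 2" "d \<in> set_pmf p"
      using criticalD(3)[OF assms(1)] by blast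
    let ?\<mu> = "total_offspring p K"
    have "K < K * d"
      using d less.prems by simp
    then have lt: "width_le_prob p n (K * d) < 1"
      using True less.prems by (intro less.hyps diff_less_mono2) auto
    have pos: "pmf ?\<mu> (K * d) > 0"
      using mult_mem_total_offspring[OF d(2)] by (simp add: pmf_positive)
    have "measure_pmf.expectation ?\<mu> (width_le_prob p n)
        \<le> measure_pmf.expectation ?\<mu> (\<lambda>j. 1 - (1 - width_le_prob p n (K * d)) * indicator {K * d} j)"
      by (intro integral_mono integrable_pmf_bounded[where B = 1])
        (auto simp: width_le_prob_bounds split: split_indicator)
    also have "\<dots> = 1 - (1 - width_le_prob p n (K * d)) * pmf ?\<mu> (K * d)"
      using integrable_pmf_bounded[of "indicator {K * d} :: nat \<Rightarrow> real" 1 ?\<mu>]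
      by (simp add: measure_pmf_single)
    also have "\<dots> < 1"
      using lt pos by simp
    finally show ?thesis
      using True by (subst width_le_prob_step) simp
  qed (subst width_le_prob_step, simp)
qed

lemma width_tail_ratio:
  assumes crit: "critical p"
  shows "(\<lambda>n. (1 - width_le_prob p n K) / (1 - width_le_prob p n 1)) \<longlonglongrightarrow> real K"
proof (rule ratio_tendsto[OF crit])
  have pos: "1 - width_le_prob p n 1 > 0" for n
    using width_le_prob_less_1[OF crit, of 1 n] by simp
  then show "\<forall>\<^sub>F n in sequentially. (1 - width_le_prob p n 1) / (1 - width_le_prob p n 1) = 1"
    by (intro always_eventually allI) (metis divide_self less_irrefl)
  show "\<forall>\<^sub>F n in sequentially. \<forall>j. 0 \<le> (1 - width_le_prob p n j) / (1 - width_le_prob p n 1)"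
    using width_le_prob_bounds by (intro always_eventually allI divide_nonneg_nonneg) auto
  have int: "integrable (measure_pmf \<mu>) (\<lambda>j. 1 - width_le_prob p n j)" for \<mu> n
    by (rule integrable_pmf_bounded[where B = 1]) (simp add: width_le_prob_bounds)
  then show "\<forall>\<^sub>F n in sequentially. integrable (measure_pmf (total_offspring p K))
      (\<lambda>j. (1 - width_le_prob p n j) / (1 - width_le_prob p n 1))" for K
    by simp
  show "\<forall>\<^sub>F n in sequentially. measure_pmf.expectation (total_offspring p K)
      (\<lambda>j. (1 - width_le_prob p n j) / (1 - width_le_prob p n 1)) =
      (1 - width_le_prob p n K) / (1 - width_le_prob p n 1)" for K
    using eventually_ge_at_top[of K]
  proof eventually_elim
    case (elim n)
    have "measure_pmf.expectation (total_offspring p K) (\<lambda>j. 1 - width_le_prob p n j)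
        = 1 - measure_pmf.expectation (total_offspring p K) (width_le_prob p n)"
      using integrable_pmf_bounded[of "width_le_prob p n" 1 "total_offspring p K"]
      by (simp add: width_le_prob_bounds)
    then show ?case
      using elim by (simp add: width_le_prob_step[of p n K])
  qed
  fix K and \<epsilon> :: real
  assume \<epsilon>: "0 < \<epsilon>" "\<epsilon> < 1"
  have "(\<lambda>n. 1 / (real n + 1)) \<longlonglongrightarrow> 0"
    using LIMSEQ_inverse_real_of_nat by (simp add: inverse_eq_divide add.commute)
  then have "\<forall>\<^sub>F n in sequentially. 1 / (real n + 1) < \<epsilon>"
    using \<epsilon> by (intro order_tendstoD)
  then show "\<forall>\<^sub>F n in sequentially. (1 - \<epsilon>) * ((1 - width_le_prob p n K) / (1 - width_le_prob p n 1)) + (1 - \<epsilon>)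
      \<le> (1 - width_le_prob p n (Suc K)) / (1 - width_le_prob p n 1)"
  proof eventually_elim
    case (elim n)
    define r where "r K = 1 - width_le_prob p n K" for K
    have r1: "0 < r 1" "r 1 \<le> \<epsilon>" and rK: "0 \<le> r K"
      using pos[of n] width_gt_prob_le[OF crit, of n 1] elim width_le_prob_bounds
      by (auto simp: r_def)
    have "width_le_prob p n (Suc K) \<le> (1 - r K) * (1 - r 1)"
      using width_le_prob_add_le[of p n K 1] by (simp add: r_def)
    then have "(1 - r 1) * r K + r 1 \<le> r (Suc K)"
      by (simp add: r_def[of "Suc K"] algebra_simps)
    moreover have "(1 - \<epsilon>) * r K + (1 - \<epsilon>) * r 1 \<le> (1 - r 1) * r K + r 1"
    proof (rule add_mono)
      show "(1 - \<epsilon>) * r K \<le> (1 - r 1) * r K"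
        using r1 rK by (intro mult_right_mono) auto
      show "(1 - \<epsilon>) * r 1 \<le> r 1"
        using r1 \<epsilon> by (simp add: algebra_simps)
    qed
    ultimately have "((1 - \<epsilon>) * r K + (1 - \<epsilon>) * r 1) / r 1 \<le> r (Suc K) / r 1"
      using r1 by (intro divide_right_mono) auto
    then show ?case
      using r1 unfolding r_def[symmetric] by (simp add: add_divide_distrib)
  qed
qed

section \<open>Extinction\<close>

text \<open>
  The probability that the descendants of \<open>K\<close> ancestors are extinct at height \<open>h\<close>.
\<close>

definition extinct_prob :: "nat pmf \<Rightarrow> nat \<Rightarrow> nat \<Rightarrow> real" where
  "extinct_prob p h K = measure_pmf.prob (gen_sizes p h K) {x. x ! h = 0}"

lemma gen_sizes_absorbing:
  "x \<in> set_pmf (gen_sizes p H K) \<Longrightarrow> x ! h = 0 \<Longrightarrow> h \<le> l \<Longrightarrow> l \<le> H \<Longrightarrow> x ! l = 0"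
proof (induction H arbitrary: K x h l)
  case (Suc H)
  show ?case
  proof (cases h)
    case 0
    then have "K = 0"
      using Suc.prems by auto
    then have "x = replicate (Suc (Suc H)) 0"
      using Suc.prems(1) gen_sizes_0[of p "Suc H"] by (metis set_return_pmf singletonD)
    then show ?thesis
      using Suc.prems(4) by (simp del: replicate.simps)
  next
    case (Suc h')
    then obtain j x' where "x = K # x'" "x' \<in> set_pmf (gen_sizes p H j)"
      using Suc.prems(1) by auto
    then show ?thesis
      using Suc Suc.prems Suc.IH[of x' j h' "l - 1"] by (cases l) auto
  qed
qed auto

lemma gen_sizes_le:
  assumes "\<And>j. j \<in> set_pmf p \<Longrightarrow> j \<le> D"
  shows "x \<in> set_pmf (gen_sizes p H K) \<Longrightarrow> l \<le> H \<Longrightarrow> x ! l \<le> K * D ^ l"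
proof (induction H arbitrary: K x l)
  case (Suc H)
  show ?case
  proof (cases l)
    case 0
    then show ?thesis using Suc.prems by auto
  next
    case (Suc l')
    then obtain j x' where x': "x = K # x'" "x' \<in> set_pmf (gen_sizes p H j)"
      and j: "j \<in> set_pmf (total_offspring p K)"
      using Suc.prems(1) by auto
    have "x ! l \<le> j * D ^ l'"
      using Suc Suc.IH[OF x'(2), of l'] Suc.prems x' by simp
    also have "\<dots> \<le> K * D * D ^ l'"
      using total_offspring_le[OF assms j] by (intro mult_right_mono) auto
    finally show ?thesis
      using Suc by (simp add: mult.assoc)
  qed
qed auto

lemma prob_gen_sizes_extinct:
  "h \<le> H \<Longrightarrow> measure_pmf.prob (gen_sizes p H K) {x. x ! h = 0} = extinct_prob p h K"
proof (induction h arbitrary: H K)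
  case 0
  then show ?case
    by (cases H; cases "K = 0") (auto simp: extinct_prob_def prob_gen_sizes_Suc simp del: gen_sizes.simps(2))
next
  case (Suc h)
  then obtain H' where H': "H = Suc H'" "h \<le> H'"
    by (cases H) auto
  show ?case
    by (simp add: H' extinct_prob_def[of p "Suc h"] prob_gen_sizes_Suc Suc.IH
        del: gen_sizes.simps)
qed

lemma extinct_prob_add: "extinct_prob p h (K + L) = extinct_prob p h K * extinct_prob p h L"
proof -
  have "extinct_prob p h (K + L) = measure_pmf.prob (pair_pmf (gen_sizes p h K) (gen_sizes p h L))
     ({x. x ! h = 0} \<times> {x. x ! h = 0})"
    unfolding extinct_prob_def prob_gen_sizes_add
    by (intro measure_pmf.finite_measure_eq_AE AE_pmfI) (auto dest!: length_gen_sizes)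
  then show ?thesis
    by (simp add: prob_pair_pmf_Times extinct_prob_def)
qed

lemma extinct_prob_power: "extinct_prob p h K = extinct_prob p h 1 ^ K"
proof (induction K)
  case 0
  then show ?case
    by (simp add: extinct_prob_def del: replicate.simps)
next
  case (Suc K)
  then show ?case
    using extinct_prob_add[of p h K 1] by simp
qed

lemma extinct_prob_bounds: "0 \<le> extinct_prob p h K" "extinct_prob p h K \<le> 1"
  by (auto simp: extinct_prob_def)

text \<open>
  The extinction probabilities of one ancestor increase to a fixed point of the generating function
  \<open>a \<mapsto> E a\<^sup>j\<close> of the offspring number \<open>j\<close>. By Bernoulli's inequality, which is strict at some \<open>j \<ge> 2\<close> in the support of \<open>p\<close>,
  the only fixed point in \<open>[0, 1]\<close> is 1.
\<close>

lemma extinct_prob_tendsto_1: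
  assumes crit: "critical p"
  shows "(\<lambda>h. extinct_prob p h K) \<longlonglongrightarrow> 1"
proof -
  let ?b = "\<lambda>h. extinct_prob p h 1"
  have rec: "?b (Suc h) = measure_pmf.expectation p (\<lambda>j. ?b h ^ j)" for h
  proof -
    have "?b (Suc h) = measure_pmf.expectation (total_offspring p (Suc 0)) (extinct_prob p h)"
      by (simp add: extinct_prob_def[of p "Suc h"] prob_gen_sizes_Suc prob_gen_sizes_extinct
          del: gen_sizes.simps total_offspring.simps)
    also have "extinct_prob p h = (\<lambda>j. ?b h ^ j)"
      using extinct_prob_power by blast
    finally show ?thesis
      by (simp del: total_offspring.simps)
  qed
  have "?b h \<le> ?b (Suc h)" for h
  proof -
    have "?b h = measure_pmf.prob (gen_sizes p (Suc h) 1) {x. x ! h = 0}"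
      by (rule prob_gen_sizes_extinct[symmetric]) simp
    also have "\<dots> \<le> ?b (Suc h)"
      unfolding extinct_prob_def
      by (intro measure_pmf.finite_measure_mono_AE AE_pmfI impI)
        (auto intro: gen_sizes_absorbing[of _ p "Suc h" 1 h] simp del: gen_sizes.simps)
    finally show ?thesis .
  qed
  then have "incseq ?b"
    by (rule incseq_SucI)
  then obtain a where a: "?b \<longlonglongrightarrow> a"
    using extinct_prob_bounds(2) by (metis incseq_convergent)
  have a01: "0 \<le> a" "a \<le> 1"
    by (rule LIMSEQ_le_const[OF a], simp add: extinct_prob_bounds)
      (rule LIMSEQ_le_const2[OF a], simp add: extinct_prob_bounds)
  have "(\<lambda>h. ?b (Suc h)) \<longlonglongrightarrow> measure_pmf.expectation p (\<lambda>j. a ^ j)"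
    unfolding rec
    by (intro tendsto_expectation_pmf[where B = 1] tendsto_power a)
      (auto simp: extinct_prob_bounds power_le_one)
  then have fix_a: "measure_pmf.expectation p (\<lambda>j. a ^ j) = a"
    using LIMSEQ_Suc[OF a] LIMSEQ_unique by blast
  have "a = 1"
  proof (rule ccontr)
    assume "a \<noteq> 1"
    then have a1: "a < 1"
      using a01 by simp
    define g where "g j = a ^ j - 1 + real j * (1 - a)" for j
    have g0: "0 \<le> g j" for j
      using Bernoulli_inequality[of "a - 1" j] a01 by (simp add: g_def algebra_simps)
    obtain d where d: "d \<ge> 2" "d \<in> set_pmf p"
      using criticalD(3)[OF crit] by blast
    then obtain e where e: "d = Suc e" "e \<ge> 1"
      by (cases d) auto
    \<comment> \<open>Strictness of Bernoulli's inequality at \<open>d \<ge> 2\<close> follows from one step of its induction: \<open>g(e + 1) = a g(e) + e (1 - a)\<^sup>2\<close>.\<close>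
    have "g d = a * g e + real e * (1 - a)\<^sup>2"
      by (simp add: e g_def algebra_simps power2_eq_square)
    then have gd: "g d > 0"
      using e a1 a01 g0[of e] by (simp add: add_nonneg_pos)
    note p = criticalD(1,2)[OF crit]
    have int: "integrable (measure_pmf p) (\<lambda>j. a ^ j)"
      using a01 by (intro integrable_pmf_bounded[where B = 1]) (auto simp: power_le_one)
    then have intg: "integrable (measure_pmf p) g"
      using p unfolding g_def by simp
    have "measure_pmf.expectation p g = 0"
      using p int fix_a unfolding g_def by simp
    then have "AE j in p. g j = 0"
      using integral_nonneg_eq_0_iff_AE[OF intg] g0 by simp
    then show False
      using d gd by (auto simp: AE_measure_pmf_iff)
  qed
  then show ?thesis
    using tendsto_power[OF a, of K] extinct_prob_power[of p _ K] by simp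
qed

section \<open>Forests of a given width\<close>

text \<open>
  For \<open>n \<ge> 1\<close>, the probability that the width of a forest of \<open>K\<close> trees is exactly \<open>n\<close>. The natural
  subtraction makes it 0 at \<open>n = 0\<close>, a case that plays no role.
\<close>

definition width_eq_prob :: "nat pmf \<Rightarrow> nat \<Rightarrow> nat \<Rightarrow> real" where
  "width_eq_prob p n K = width_le_prob p n K - width_le_prob p (n - 1) K"

lemma prob_max_eq:
  assumes "n \<ge> 1"
  shows "measure_pmf.prob (gen_sizes p h K) {x. (\<forall>y\<in>set x. y \<le> n) \<and> n \<in> set x} =
         max_le_prob p n h K - max_le_prob p (n - 1) h K"
proof -
  have "{x. (\<forall>y\<in>set x. y \<le> n) \<and> n \<in> set x} = {x. \<forall>y\<in>set x. y \<le> n} - {x. \<forall>y\<in>set x. y \<le> n - 1}"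
  proof -
    have "y \<le> n - 1 \<longleftrightarrow> y \<le> n \<and> y \<noteq> n" for y
      using assms by linarith
    then show ?thesis by auto
  qed
  then show ?thesis
    unfolding max_le_prob_def by (subst measure_pmf.finite_measure_Diff[symmetric]) force+
qed

text \<open>
  If offspring numbers are bounded by \<open>D\<close>, then a total of \<open>K + L\<close> ancestors has at most
  \<open>(K + L) D\<^sup>h < n\<close> descendants in any generation up to \<open>h\<close>. A group reaching the maximum \<open>n\<close> therefore
  does so after height \<open>h\<close>, when a group that is extinct at height \<open>h\<close> no longer contributes. In
  particular the two groups cannot exchange these roles, and the two events are disjoint.
\<close>

lemma max_eq_prob_superadditive:
  assumes D: "\<And>j. j \<in> set_pmf p \<Longrightarrow> j \<le> D" "D \<ge> 1"
    and hH: "h \<le> H" and n: "n > (K + L) * D ^ h"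
  defines "v \<equiv> \<lambda>K. max_le_prob p n H K - max_le_prob p (n - 1) H K"
  shows "v K * extinct_prob p h L + extinct_prob p h K * v L \<le> v (K + L)"
proof -
  define M where "M = {x. (\<forall>y\<in>set x. y \<le> n) \<and> n \<in> set x}"
  define E where "E = {x :: nat list. x ! h = 0}"
  define \<mu> where "\<mu> = pair_pmf (gen_sizes p H K) (gen_sizes p H L)"
  have n1: "n \<ge> 1"
    using n by simp
  have v: "v K = measure_pmf.prob (gen_sizes p H K) M" for K
    unfolding v_def M_def using prob_max_eq[OF n1] by simp
  have E: "extinct_prob p h K = measure_pmf.prob (gen_sizes p H K) E" for K
    unfolding E_def using prob_gen_sizes_extinct[OF hH] by simp
  have pow: "D ^ l \<le> D ^ h" if "l \<le> h" for l
    using D(2) that by (intro power_increasing) auto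
  have late: "\<exists>l. h < l \<and> l \<le> H \<and> x ! l = n"
    if x: "x \<in> set_pmf (gen_sizes p H J)" "x \<in> M" and J: "J \<le> K + L" for x J
  proof -
    obtain l where l: "l \<le> H" "x ! l = n"
      using x length_gen_sizes[OF x(1)] by (auto simp: M_def in_set_conv_nth less_Suc_eq_le)
    have "\<not> l \<le> h"
    proof
      assume "l \<le> h"
      have "n \<le> J * D ^ l"
        using gen_sizes_le[OF D(1) x(1) l(1)] l by simp
      also have "\<dots> \<le> (K + L) * D ^ h"
        using J pow[OF \<open>l \<le> h\<close>] by (rule mult_le_mono)
      finally show False using n by simp
    qed
    then show ?thesis using l by (auto simp: not_le)
  qed
  have not_both: "x \<notin> E" if x: "x \<in> set_pmf (gen_sizes p H J)" "x \<in> M" "J \<le> K + L" for x J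
  proof
    assume "x \<in> E"
    obtain l where "h < l" "l \<le> H" "x ! l = n"
      using late[OF x] by blast
    then show False
      using gen_sizes_absorbing[OF x(1), of h l] \<open>x \<in> E\<close> n1 by (simp add: E_def)
  qed
  have sum_M: "map2 (+) x y \<in> M"
    if x: "x \<in> set_pmf (gen_sizes p H J)" "x \<in> M" and y: "y \<in> set_pmf (gen_sizes p H J')" "y \<in> E"
      and J: "J + J' = K + L" for x y J J'
  proof -
    note len = length_gen_sizes[OF x(1)] length_gen_sizes[OF y(1)]
    have y0: "y ! l = 0" if "h \<le> l" "l \<le> H" for l
      using gen_sizes_absorbing[OF y(1) _ that] y(2) by (simp add: E_def)
    obtain l where l: "h < l" "l \<le> H" "x ! l = n"
      using late[OF x] J by auto
    have "x ! i + y ! i \<le> n" if "i \<le> H" for i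
    proof (cases "i \<le> h")
      case True
      have "x ! i + y ! i \<le> J * D ^ i + J' * D ^ i"
        using gen_sizes_le[OF D(1) x(1) that] gen_sizes_le[OF D(1) y(1) that] by simp
      also have "\<dots> \<le> (K + L) * D ^ h"
        using pow[OF True] by (simp flip: J add: add_mult_distrib[symmetric])
      finally show ?thesis using n by simp
    next
      case False
      then show ?thesis
        using y0[of i] that x(2) len by (auto simp: M_def)
    qed
    moreover have "x ! l + y ! l = n"
      using l y0[of l] by simp
    ultimately show ?thesis
      using l len by (auto simp: M_def all_set_conv_all_nth in_set_conv_nth less_Suc_eq_le)
  qed
  have "v K * extinct_prob p h L + extinct_prob p h K * v L
      = measure_pmf.prob \<mu> (M \<times> E) + measure_pmf.prob \<mu> (E \<times> M)"
    by (simp add: v E \<mu>_def prob_pair_pmf_Times)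
  also have "\<dots> = measure_pmf.prob \<mu> (M \<times> E \<union> E \<times> M)"
    by (rule measure_Un_AE[symmetric])
      (use not_both[of _ K] in \<open>auto intro!: AE_pmfI simp: \<mu>_def measure_pmf.fmeasurable_eq_sets\<close>)
  also have "\<dots> \<le> measure_pmf.prob \<mu> {(x, y). map2 (+) x y \<in> M}"
  proof (intro measure_pmf.finite_measure_mono_AE AE_pmfI impI)
    fix z
    assume "z \<in> set_pmf \<mu>" "z \<in> M \<times> E \<union> E \<times> M"
    then obtain x y where z: "z = (x, y)" and x: "x \<in> set_pmf (gen_sizes p H K)"
      and y: "y \<in> set_pmf (gen_sizes p H L)" and "x \<in> M \<and> y \<in> E \<or> y \<in> M \<and> x \<in> E"
      by (auto simp: \<mu>_def)
    moreover have "map2 (+) x y = map2 (+) y x"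
      using length_gen_sizes[OF x] length_gen_sizes[OF y] by (intro nth_equalityI) auto
    ultimately have "map2 (+) x y \<in> M"
      using sum_M[OF x _ y] sum_M[OF y _ x] by auto
    then show "z \<in> {(x, y). map2 (+) x y \<in> M}"
      by (simp add: z)
  qed auto
  also have "\<dots> = v (K + L)"
    by (simp add: v \<mu>_def prob_gen_sizes_add)
  finally show ?thesis .
qed

lemma width_eq_prob_superadditive:
  assumes "\<And>j. j \<in> set_pmf p \<Longrightarrow> j \<le> D" "D \<ge> 1" "n > (K + L) * D ^ h"
  shows "width_eq_prob p n K * extinct_prob p h L + extinct_prob p h K * width_eq_prob p n L
           \<le> width_eq_prob p n (K + L)"
proof -
  let ?v = "\<lambda>H K. max_le_prob p n H K - max_le_prob p (n - 1) H K"
  have lim: "(\<lambda>H. ?v H J) \<longlonglongrightarrow> width_eq_prob p n J" for J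
    unfolding width_eq_prob_def by (intro tendsto_diff tendsto_width_le_prob)
  show ?thesis
    by (rule LIMSEQ_le[OF tendsto_add[OF tendsto_mult_right[OF lim] tendsto_mult_left[OF lim]] lim])
      (use max_eq_prob_superadditive[OF assms(1,2) _ assms(3)] in blast)
qed

lemma width_eq_prob_bounds: "0 \<le> width_eq_prob p n K" "width_eq_prob p n K \<le> 1"
  using width_le_prob_bounds[of p "n - 1" K] width_le_prob_bounds[of p n K]
    width_le_prob_mono[of "n - 1" n p K]
  by (auto simp: width_eq_prob_def)

lemma width_eq_ratio:
  assumes crit: "critical p" and bdd: "bdd_above (set_pmf p)"
  shows "((\<lambda>n. width_eq_prob p n K / width_eq_prob p n 1) \<longlongrightarrow> real K)
    (inf sequentially (principal {n. width_eq_prob p n 1 > 0}))"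
proof (rule ratio_tendsto[OF crit])
  let ?F = "inf sequentially (principal {n. width_eq_prob p n 1 > 0})"
  have pos: "\<forall>\<^sub>F n in ?F. width_eq_prob p n 1 > 0"
    by (simp add: eventually_inf_principal)
  have ev: "\<forall>\<^sub>F n in ?F. n > m" for m
    using eventually_gt_at_top[of m]
    unfolding eventually_inf_principal by (rule eventually_mono) simp
  show "\<forall>\<^sub>F n in ?F. width_eq_prob p n 1 / width_eq_prob p n 1 = 1"
    using pos by eventually_elim simp
  show "\<forall>\<^sub>F n in ?F. \<forall>j. 0 \<le> width_eq_prob p n j / width_eq_prob p n 1"
    by (simp add: width_eq_prob_bounds)
  show "\<forall>\<^sub>F n in ?F. integrable (measure_pmf (total_offspring p K))
      (\<lambda>j. width_eq_prob p n j / width_eq_prob p n 1)" for K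
    using integrable_pmf_bounded[of "width_eq_prob p _" 1] by (simp add: width_eq_prob_bounds)
  show "\<forall>\<^sub>F n in ?F. measure_pmf.expectation (total_offspring p K)
      (\<lambda>j. width_eq_prob p n j / width_eq_prob p n 1) =
      width_eq_prob p n K / width_eq_prob p n 1" for K
    using ev[of K]
  proof eventually_elim
    case (elim n)
    let ?\<mu> = "total_offspring p K"
    have int: "integrable (measure_pmf ?\<mu>) (width_le_prob p m)" for m
      by (rule integrable_pmf_bounded[where B = 1]) (simp add: width_le_prob_bounds)
    have "measure_pmf.expectation ?\<mu> (width_eq_prob p n)
        = measure_pmf.expectation ?\<mu> (width_le_prob p n) - measure_pmf.expectation ?\<mu> (width_le_prob p (n - 1))"
      unfolding width_eq_prob_def using int by simp
    also have "\<dots> = width_eq_prob p n K"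
    proof -
      have "width_le_prob p m K = measure_pmf.expectation ?\<mu> (width_le_prob p m)" if "K \<le> m" for m
        using that by (subst width_le_prob_step) simp
      from this[of n] this[of "n - 1"] show ?thesis
        using elim by (simp add: width_eq_prob_def)
    qed
    finally show ?case
      by simp
  qed
  fix K and \<epsilon> :: real
  assume \<epsilon>: "0 < \<epsilon>" "\<epsilon> < 1"
  obtain D where "\<And>j. j \<in> set_pmf p \<Longrightarrow> j \<le> D"
    using bdd by (auto simp: bdd_above_def)
  then have D: "\<And>j. j \<in> set_pmf p \<Longrightarrow> j \<le> Suc D"
    using le_SucI by blast
  have "\<forall>\<^sub>F h in sequentially. 1 - \<epsilon> < extinct_prob p h 1 \<and> 1 - \<epsilon> < extinct_prob p h K"
    using \<epsilon> by (intro eventually_conj order_tendstoD[OF extinct_prob_tendsto_1[OF crit]]) auto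
  then obtain h where h: "1 - \<epsilon> < extinct_prob p h 1" "1 - \<epsilon> < extinct_prob p h K"
    using eventually_happens'[OF sequentially_bot] by blast
  show "\<forall>\<^sub>F n in ?F. (1 - \<epsilon>) * (width_eq_prob p n K / width_eq_prob p n 1) + (1 - \<epsilon>)
      \<le> width_eq_prob p n (Suc K) / width_eq_prob p n 1"
    using ev[of "(K + 1) * Suc D ^ h"] pos
  proof eventually_elim
    case (elim n)
    define s where "s = width_eq_prob p n"
    have s: "s 1 > 0" "0 \<le> s K"
      using elim width_eq_prob_bounds by (auto simp: s_def)
    have "(1 - \<epsilon>) * s K + (1 - \<epsilon>) * s 1 \<le> s K * extinct_prob p h 1 + extinct_prob p h K * s 1"
      using h s \<epsilon> extinct_prob_bounds
      by (subst mult.commute, intro add_mono mult_mono) auto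
    also have "\<dots> \<le> s (Suc K)"
      using width_eq_prob_superadditive[OF D _ elim(1)] by (simp add: s_def)
    finally have "((1 - \<epsilon>) * s K + (1 - \<epsilon>) * s 1) / s 1 \<le> s (Suc K) / s 1"
      using s by (intro divide_right_mono) auto
    then show ?case
      using s unfolding s_def[symmetric] by (simp add: add_divide_distrib)
  qed
qed

text \<open>
  Otherwise the tail of the width would be eventually constant; but it is positive and tends to 0.
\<close>

lemma width_eq_prob_infinite:
  assumes crit: "critical p"
  shows "infinite {n. width_eq_prob p n 1 > 0}"
proof
  assume "finite {n. width_eq_prob p n 1 > 0}"
  then obtain N where N: "\<And>n. width_eq_prob p n 1 > 0 \<Longrightarrow> n < N"
    by (metis (mono_tags) finite_nat_set_iff_bounded mem_Collect_eq)
  have "width_le_prob p (N + i) 1 = width_le_prob p N 1" for i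
  proof (induction i)
    case (Suc i)
    have "\<not> width_eq_prob p (N + Suc i) 1 > 0"
      using N[of "N + Suc i"] by auto
    then show ?case
      using Suc width_eq_prob_bounds(1)[of p "N + Suc i" 1] by (simp add: width_eq_prob_def)
  qed simp
  then have le: "1 - width_le_prob p N 1 \<le> 1 / (real (N + i) + 1)" for i
    using width_gt_prob_le[OF crit, of "N + i" 1] by simp
  have "(\<lambda>i. 1 / (real (i + N) + 1)) \<longlonglongrightarrow> 0"
    using LIMSEQ_inverse_real_of_nat
    by (intro LIMSEQ_ignore_initial_segment) (simp add: inverse_eq_divide add.commute)
  then have "1 - width_le_prob p N 1 \<le> 0"
    by (rule LIMSEQ_le_const) (use le in \<open>auto simp: add.commute\<close>)
  then show False
    using width_le_prob_less_1[OF crit, of 1 N] by simp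
qed

section \<open>Generation sizes of trees\<close>

lemma ordered_tree_appendD: "ordered_tree t \<Longrightarrow> u @ v \<in> t \<Longrightarrow> u \<in> t"
proof (induction v rule: rev_induct)
  case (snoc i v)
  then have "(u @ v) @ [i] \<in> t"
    by simp
  then have "u @ v \<in> t"
    using snoc.prems(1) unfolding ordered_tree_def by blast
  then show ?case
    using snoc by blast
qed simp

lemma ordered_tree_subtree:
  assumes "ordered_tree t" "[i] \<in> t"
  shows "ordered_tree (subtree i t)"
proof -
  have t: "\<And>u i. u @ [i] \<in> t \<Longrightarrow> u \<in> t" "\<And>u. u \<in> t \<Longrightarrow> \<exists>c. \<forall>i. u @ [i] \<in> t \<longleftrightarrow> i < c"
    using assms(1) unfolding ordered_tree_def by blast+
  show ?thesis
    unfolding ordered_tree_def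
  proof (intro conjI allI impI ballI)
    show "[] \<in> subtree i t"
      using assms(2) by (simp add: subtree_def)
    show "u \<in> subtree i t" if "u @ [j] \<in> subtree i t" for u j
      using t(1)[of "i # u" j] that by (simp add: subtree_def)
    show "\<exists>c. \<forall>j. u @ [j] \<in> subtree i t \<longleftrightarrow> j < c" if "u \<in> subtree i t" for u
      using t(2)[of "i # u"] that by (simp add: subtree_def)
  qed
qed

lemma finite_level:
  assumes "ordered_tree t"
  shows "finite {u \<in> t. length u = h}"
proof (induction h)
  case (Suc h)
  have "\<forall>u\<in>t. \<exists>c. \<forall>i. u @ [i] \<in> t \<longleftrightarrow> i < c"
    using assms unfolding ordered_tree_def by blast
  then obtain c where c: "\<And>u i. u \<in> t \<Longrightarrow> u @ [i] \<in> t \<longleftrightarrow> i < c u"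
    by metis
  have "{u \<in> t. length u = Suc h} \<subseteq> (\<Union>u\<in>{u \<in> t. length u = h}. (\<lambda>i. u @ [i]) ` {..<c u})"
  proof
    fix w
    assume w: "w \<in> {u \<in> t. length u = Suc h}"
    then obtain u i where ui: "w = u @ [i]"
      by (cases w rule: rev_cases) auto
    then have "u \<in> t"
      using w assms ordered_tree_appendD by blast
    then show "w \<in> (\<Union>u\<in>{u \<in> t. length u = h}. (\<lambda>i. u @ [i]) ` {..<c u})"
      using w ui c[of u i] by auto
  qed
  then show ?case
    by (rule finite_subset) (use Suc in simp)
next
  case 0
  have "{u \<in> t. length u = 0} \<subseteq> {[]}"
    by auto
  then show ?case
    by (rule finite_subset) simp
qed

lemma Y_0: "ordered_tree t \<Longrightarrow> Y 0 t = 1"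
proof -
  assume "ordered_tree t"
  then have "[] \<in> t"
    unfolding ordered_tree_def by blast
  then have "{u \<in> t. length u = 0} = {[]}"
    by auto
  then show ?thesis
    by (simp add: Y_def)
qed

lemma root_children_eq: "ordered_tree t \<Longrightarrow> [i] \<in> t \<longleftrightarrow> i < root_children t"
proof -
  assume t: "ordered_tree t"
  then obtain c where c: "\<And>i. [] @ [i] \<in> t \<longleftrightarrow> i < c"
    unfolding ordered_tree_def by blast
  then have "{i. [i] \<in> t} = {..<c}"
    by auto
  then show ?thesis
    using c by (simp add: root_children_def)
qed

lemma Y_Suc:
  assumes t: "ordered_tree t"
  shows "Y (Suc h) t = (\<Sum>i<root_children t. Y h (subtree i t))"
proof -
  let ?L = "\<lambda>i. {u \<in> subtree i t. length u = h}"
  have "{u \<in> t. length u = Suc h} = (\<Union>i<root_children t. Cons i ` ?L i)"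
  proof (intro set_eqI iffI)
    fix w
    assume w: "w \<in> {u \<in> t. length u = Suc h}"
    then obtain i u where iu: "w = i # u"
      by (cases w) auto
    have "[i] \<in> t"
      using ordered_tree_appendD[OF t, of "[i]" u] w iu by simp
    then show "w \<in> (\<Union>i<root_children t. Cons i ` ?L i)"
      using w iu root_children_eq[OF t] by (auto simp: subtree_def)
  qed (auto simp: subtree_def)
  then have "Y (Suc h) t = card (\<Union>i<root_children t. Cons i ` ?L i)"
    by (simp add: Y_def)
  also have "\<dots> = (\<Sum>i<root_children t. card (Cons i ` ?L i))"
    using finite_level[OF ordered_tree_subtree[OF t]] root_children_eq[OF t]
    by (intro card_UN_disjoint) auto
  also have "\<dots> = (\<Sum>i<root_children t. Y h (subtree i t))"
    by (simp add: card_image Y_def)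
  finally show ?thesis .
qed

text \<open>
  The list of generation sizes of a forest up to height \<open>h\<close>.
\<close>

definition profile :: "nat \<Rightarrow> tree list \<Rightarrow> nat list" where
  "profile h ts = map (\<lambda>l. Y_forest l ts) [0..<Suc h]"

lemma profile_Suc:
  assumes "ordered_tree t"
  shows "profile (Suc h) [t] = 1 # profile h (map (\<lambda>i. subtree i t) [0..<root_children t])"
proof -
  have "Y_forest (Suc l) [t] = Y_forest l (map (\<lambda>i. subtree i t) [0..<root_children t])" for l
    by (simp add: Y_forest_def Y_Suc[OF assms] interv_sum_list_conv_sum_set_nat atLeast0LessThan o_def)
  moreover have "[0..<Suc (Suc h)] = 0 # map Suc [0..<Suc h]"
    by (subst upt_conv_Cons) (simp_all only: map_Suc_upt zero_less_Suc)
  moreover have "Y_forest 0 [t] = 1"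
    by (simp add: Y_forest_def Y_0[OF assms])
  ultimately show ?thesis
    by (simp add: profile_def o_def del: upt_Suc)
qed

lemma profile_eq_foldr:
  "profile h ts = foldr (map2 (+)) (map (\<lambda>t. profile h [t]) ts) (replicate (Suc h) 0)"
proof (induction ts)
  case Nil
  show ?case by (rule nth_equalityI) (auto simp: profile_def Y_forest_def simp del: upt_Suc replicate.simps)
next
  case (Cons t ts)
  have "profile h (t # ts) = map2 (+) (profile h [t]) (profile h ts)"
    by (rule nth_equalityI) (auto simp: profile_def Y_forest_def simp del: upt_Suc)
  then show ?case
    using Cons by simp
qed

section \<open>Laws of the generation sizes of random trees\<close>

lemma gen_sizes_eq_replicate:
  "gen_sizes p h K = map_pmf (\<lambda>xss. foldr (map2 (+)) xss (replicate (Suc h) 0))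
     (replicate_pmf K (gen_sizes p h 1))"
proof (induction K)
  case (Suc K)
  show ?case
    using gen_sizes_add[of p h 1 K] unfolding Suc
    by (simp add: pair_pmf_def map_pmf_def bind_assoc_pmf bind_return_pmf)
qed simp

lemma pmf_replicate_pmf:
  "pmf (replicate_pmf j \<nu>) xs = (if length xs = j then \<Prod>i<j. pmf \<nu> (xs ! i) else 0)"
proof (induction j arbitrary: xs)
  case 0
  then show ?case by (auto simp: pmf_return split: split_indicator)
next
  case (Suc j)
  have eq: "replicate_pmf (Suc j) \<nu> = map_pmf (\<lambda>(x, xs). x # xs) (pair_pmf \<nu> (replicate_pmf j \<nu>))"
    by (simp add: pair_pmf_def map_pmf_def bind_assoc_pmf bind_return_pmf)
  show ?case
  proof (cases xs)
    case Nil
    then show ?thesis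
      by (auto simp: pmf_eq_0_set_pmf)
  next
    case (Cons y ys)
    have "pmf (map_pmf (\<lambda>(x, xs). x # xs) (pair_pmf \<nu> (replicate_pmf j \<nu>))) ((\<lambda>(x, xs). x # xs) (y, ys))
        = pmf (pair_pmf \<nu> (replicate_pmf j \<nu>)) (y, ys)"
      by (rule pmf_map_inj') (auto simp: inj_def)
    then show ?thesis
      unfolding eq Cons by (simp add: pmf_pair Suc prod.lessThan_Suc_shift del: prod.lessThan_Suc)
  qed
qed

text \<open>
  The random variable \<open>X\<close>, measurable for the discrete \<open>\<sigma>\<close>-algebra, has law \<open>\<nu>\<close>.
\<close>

definition has_law :: "'a measure \<Rightarrow> ('a \<Rightarrow> 'b) \<Rightarrow> 'b pmf \<Rightarrow> bool" where
  "has_law M X \<nu> \<longleftrightarrow> (\<forall>A. {\<omega> \<in> space M. X \<omega> \<in> A} \<in> sets M \<and>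
     measure M {\<omega> \<in> space M. X \<omega> \<in> A} = measure_pmf.prob \<nu> A)"

lemma has_lawI:
  fixes X :: "'a \<Rightarrow> 'b::countable"
  assumes M: "prob_space M"
    and sets: "\<And>x. {\<omega> \<in> space M. X \<omega> = x} \<in> sets M"
    and eq: "\<And>x. measure M {\<omega> \<in> space M. X \<omega> = x} = pmf \<nu> x"
  shows "has_law M X \<nu>"
proof -
  interpret prob_space M by fact
  have X: "X \<in> measurable M (count_space UNIV)"
    using sets by (auto simp: measurable_count_space_eq2_countable vimage_def Int_def conj_commute)
  have "distr M (count_space UNIV) X = measure_pmf \<nu>"
  proof (rule measure_eqI_countable[where A = UNIV])
    fix x
    show "emeasure (distr M (count_space UNIV) X) {x} = emeasure \<nu> {x}"
      using eq[of x]
      by (simp add: emeasure_distr[OF X] emeasure_pmf_single emeasure_eq_measure vimage_def Int_def conj_commute)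
  qed auto
  then have "measure_pmf.prob \<nu> A = measure M {\<omega> \<in> space M. X \<omega> \<in> A}" for A
    using measure_distr[OF X, of A] by (simp add: vimage_def Int_def conj_commute)
  moreover have "{\<omega> \<in> space M. X \<omega> \<in> A} \<in> sets M" for A
    using measurable_sets[OF X, of A] by (simp add: vimage_def Int_def conj_commute)
  ultimately show ?thesis
    by (simp add: has_law_def)
qed

lemma has_law_pmf:
  assumes "has_law M X \<nu>"
  shows "measure M {\<omega> \<in> space M. X \<omega> = x} = pmf \<nu> x"
proof -
  have "measure M {\<omega> \<in> space M. X \<omega> \<in> {x}} = measure_pmf.prob \<nu> {x}"
    using assms unfolding has_law_def by blast
  then show ?thesis
    by (simp add: measure_pmf_single)
qed

lemma has_law_map:
  assumes "has_law M X \<nu>" "\<And>\<omega>. \<omega> \<in> space M \<Longrightarrow> X' \<omega> = f (X \<omega>)"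
  shows "has_law M X' (map_pmf f \<nu>)"
proof -
  have "{\<omega> \<in> space M. X' \<omega> \<in> A} = {\<omega> \<in> space M. X \<omega> \<in> f -` A}" for A
    using assms(2) by auto
  then show ?thesis
    using assms(1) by (simp add: has_law_def del: vimage_eq)
qed

lemma space_tree_space: "space tree_space = {t. ordered_tree t}"
  by (simp add: tree_space_def space_measure_of_conv)

lemma pred_mem_tree [measurable]: "Measurable.pred tree_space (\<lambda>t. u \<in> t)"
proof -
  have "{t. ordered_tree t \<and> u \<in> t} \<in> sets tree_space"
    unfolding tree_space_def by (intro in_measure_of) auto
  then show ?thesis
    by (simp add: pred_def space_tree_space)
qed

text \<open>
  Measurability of all tree functionals below reduces to that of the number of nodes in a given set of
  words, which follows since there are only countably many finite sets of words. An infinite set counts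
  as 0, so the value 0 is treated as the complement of the positive values.
\<close>

lemma pred_card_tree [measurable]: "Measurable.pred tree_space (\<lambda>t. card (t \<inter> C) = m)"
proof -
  have *: "Measurable.pred tree_space (\<lambda>t. card (t \<inter> C) = Suc m)" for m
  proof -
    have "{t \<in> space tree_space. card (t \<inter> C) = Suc m} =
        (\<Union>F\<in>{F. finite F \<and> card F = Suc m}. {t \<in> space tree_space. \<forall>u. u \<in> t \<inter> C \<longleftrightarrow> u \<in> F})"
      (is "_ = ?U")
    proof (intro set_eqI iffI)
      fix t
      assume "t \<in> {t \<in> space tree_space. card (t \<inter> C) = Suc m}"
      then show "t \<in> ?U"
        using card_ge_0_finite[of "t \<inter> C"] by (intro UN_I[of "t \<inter> C"]) auto
    next
      fix t
      assume "t \<in> ?U"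
      then obtain F where "t \<in> space tree_space" "card F = Suc m" "t \<inter> C = F"
        by (auto intro: set_eqI)
      then show "t \<in> {t \<in> space tree_space. card (t \<inter> C) = Suc m}"
        by simp
    qed
    moreover have "?U \<in> sets tree_space"
    proof (rule sets.countable_UN'')
      show "countable {F :: nat list set. finite F \<and> card F = Suc m}"
        by (rule countable_subset[OF _ countable_Collect_finite]) auto
      show "{t \<in> space tree_space. \<forall>u. u \<in> t \<inter> C \<longleftrightarrow> u \<in> F} \<in> sets tree_space" for F
        unfolding Int_iff by measurable
    qed
    ultimately show ?thesis
      by (simp add: pred_def)
  qed
  show ?thesis
  proof (cases m)
    case 0
    have "Measurable.pred tree_space (\<lambda>t. \<not> (\<exists>m. card (t \<inter> C) = Suc m))"
      using * by measurable
    also have "(\<lambda>t. \<not> (\<exists>m. card (t \<inter> C) = Suc m)) = (\<lambda>t. card (t \<inter> C) = m)"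
      unfolding 0 by (rule ext) (metis nat.exhaust nat.distinct(1))
    finally show ?thesis .
  qed (simp add: *)
qed

lemma Y_eq_card: "Y h t = card (t \<inter> {u. length u = h})"
  by (simp add: Y_def Int_def)

lemma Y_subtree_eq_card: "Y h (subtree i t) = card (t \<inter> Cons i ` {u. length u = h})"
proof -
  have "t \<inter> Cons i ` {u. length u = h} = Cons i ` {u \<in> subtree i t. length u = h}"
    by (auto simp: subtree_def)
  then show ?thesis
    by (simp add: Y_def card_image)
qed

lemma root_children_eq_card: "root_children t = card (t \<inter> range (\<lambda>i. [i]))"
proof -
  have "t \<inter> range (\<lambda>i. [i]) = (\<lambda>i. [i]) ` {i. [i] \<in> t}"
    by auto
  then show ?thesis
    by (simp add: root_children_def card_image inj_on_def)
qed

lemma profile_eq_iff: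
  "profile h ts = xs \<longleftrightarrow> length xs = Suc h \<and> (\<forall>l\<in>{..h}. Y_forest l ts = xs ! l)"
  by (auto simp: profile_def list_eq_iff_nth_eq less_Suc_eq_le simp del: upt_Suc)

lemma pred_profile: "Measurable.pred tree_space (\<lambda>t. profile h [t] = xs)"
  by (simp add: profile_eq_iff Y_forest_def Y_eq_card)

lemma pred_profiles_subtree:
  "Measurable.pred tree_space (\<lambda>t. map (\<lambda>i. profile h [subtree i t]) [0..<root_children t] = xs)"
proof -
  have "(\<lambda>t. map (\<lambda>i. profile h [subtree i t]) [0..<root_children t] = xs) =
    (\<lambda>t. card (t \<inter> range (\<lambda>i. [i])) = length xs \<and> (\<forall>i\<in>{..<length xs}. length (xs ! i) = Suc h \<and>
       (\<forall>l\<in>{..h}. card (t \<inter> Cons i ` {u. length u = l}) = xs ! i ! l)))"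
    by (rule ext) (auto simp: list_eq_iff_nth_eq[of "map _ _"] profile_eq_iff Y_forest_def Y_subtree_eq_card
        simp flip: root_children_eq_card)
  then show ?thesis
    by simp
qed

text \<open>
  Given that the root has \<open>j\<close> children, the profiles of the \<open>j\<close> subtrees are independent and distributed
  as the profile of the whole tree.
\<close>

lemma galton_watson_profiles_subtree:
  assumes gw: "galton_watson M p \<tau>" and law: "has_law M (\<lambda>\<omega>. profile h [\<tau> \<omega>]) \<nu>"
  shows "has_law M (\<lambda>\<omega>. map (\<lambda>i. profile h [subtree i (\<tau> \<omega>)]) [0..<root_children (\<tau> \<omega>)])
    (bind_pmf p (\<lambda>j. replicate_pmf j \<nu>))"
proof -
  interpret prob_space M
    using gw by (simp add: galton_watson_def)
  have \<tau>: "\<tau> \<in> measurable M tree_space"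
    using gw by (simp add: galton_watson_def)
  have root: "\<P>(\<omega> in M. root_children (\<tau> \<omega>) = n) = pmf p n" for n
    using gw by (simp add: galton_watson_def)
  let ?X = "\<lambda>\<omega>. map (\<lambda>i. profile h [subtree i (\<tau> \<omega>)]) [0..<root_children (\<tau> \<omega>)]"
  show ?thesis
  proof (rule has_lawI)
    fix xs
    show meas: "{\<omega> \<in> space M. ?X \<omega> = xs} \<in> sets M"
      using measurable_compose[OF \<tau> pred_profiles_subtree] by (simp add: pred_def)
    let ?j = "length xs"
    have "pmf (bind_pmf p (\<lambda>j. replicate_pmf j \<nu>)) xs =
        measure_pmf.expectation p (\<lambda>j. (\<Prod>i<?j. pmf \<nu> (xs ! i)) * indicator {?j} j)"
      unfolding pmf_bind by (intro Bochner_Integration.integral_cong) (auto simp: pmf_replicate_pmf)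
    also have "\<dots> = pmf p ?j * (\<Prod>i<?j. pmf \<nu> (xs ! i))"
      by (simp add: measure_pmf_single)
    finally have rhs: "pmf (bind_pmf p (\<lambda>j. replicate_pmf j \<nu>)) xs = pmf p ?j * (\<Prod>i<?j. pmf \<nu> (xs ! i))" .
    show "prob {\<omega> \<in> space M. ?X \<omega> = xs} = pmf (bind_pmf p (\<lambda>j. replicate_pmf j \<nu>)) xs"
    proof (cases "pmf p ?j = 0")
      case True
      have "{\<omega> \<in> space M. root_children (\<tau> \<omega>) = ?j} \<in> sets M"
        using measurable_compose[OF \<tau> pred_card_tree]
        by (simp add: pred_def root_children_eq_card)
      then have "prob {\<omega> \<in> space M. ?X \<omega> = xs} \<le> \<P>(\<omega> in M. root_children (\<tau> \<omega>) = ?j)"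
        by (intro finite_measure_mono) auto
      then show ?thesis
        using True rhs root[of ?j] by (simp add: measure_le_0_iff)
    next
      case False
      then have pos: "pmf p ?j > 0"
        by (simp add: pmf_positive_iff set_pmf_iff)
      define A where "A i = {t \<in> space tree_space. profile h [t] = xs ! i}" for i
      have A: "A i \<in> sets tree_space" for i
        using pred_profile by (simp add: A_def pred_def)
      have PA: "\<P>(\<omega> in M. \<tau> \<omega> \<in> A i) = pmf \<nu> (xs ! i)" for i
      proof -
        have "{\<omega> \<in> space M. \<tau> \<omega> \<in> A i} = {\<omega> \<in> space M. profile h [\<tau> \<omega>] = xs ! i}"
          using measurable_space[OF \<tau>] by (auto simp: A_def)
        then show ?thesis
          using has_law_pmf[OF law] by simp
      qed
      have "{\<omega> \<in> space M. (\<forall>i<?j. subtree i (\<tau> \<omega>) \<in> A i) \<and> root_children (\<tau> \<omega>) = ?j}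
          = {\<omega> \<in> space M. ?X \<omega> = xs}" (is "?E = _")
      proof -
        have "subtree i (\<tau> \<omega>) \<in> space tree_space" if "\<omega> \<in> space M" "i < root_children (\<tau> \<omega>)" for i \<omega>
          using measurable_space[OF \<tau> that(1)] that(2) root_children_eq ordered_tree_subtree
          by (auto simp: space_tree_space)
        then show ?thesis
          by (auto simp: A_def list_eq_iff_nth_eq[of "map _ _"])
      qed
      moreover have "prob ?E / pmf p ?j = (\<Prod>i<?j. pmf \<nu> (xs ! i))"
        using gw pos A PA unfolding galton_watson_def cond_prob_def by (simp add: root)
      ultimately show ?thesis
        using pos rhs by (simp add: field_simps)
    qed
  qed (rule prob_space_axioms)
qed

text \<open>
  The conditional independence property of Galton--Watson trees determines the law of the generation sizes.
\<close>

lemma galton_watson_profile: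
  assumes gw: "galton_watson M p \<tau>"
  shows "has_law M (\<lambda>\<omega>. profile h [\<tau> \<omega>]) (gen_sizes p h 1)"
proof (induction h)
  case 0
  interpret prob_space M
    using gw by (simp add: galton_watson_def)
  have "profile 0 [\<tau> \<omega>] = [1]" if "\<omega> \<in> space M" for \<omega>
    using measurable_space[of \<tau> M tree_space] gw that
    by (simp add: galton_watson_def space_tree_space profile_def Y_forest_def Y_0)
  then have "{\<omega> \<in> space M. profile 0 [\<tau> \<omega>] = x} = (if x = [1] then space M else {})" for x
    by auto
  then show ?case
    by (intro has_lawI) (auto simp: prob_space prob_space_axioms)
next
  case (Suc h)
  let ?f = "\<lambda>xss. foldr (map2 (+)) xss (replicate (Suc h) 0)"
  let ?X = "\<lambda>\<omega>. map (\<lambda>i. profile h [subtree i (\<tau> \<omega>)]) [0..<root_children (\<tau> \<omega>)]"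
  have "has_law M (\<lambda>\<omega>. profile (Suc h) [\<tau> \<omega>]) (map_pmf (\<lambda>xss. 1 # ?f xss)
      (bind_pmf p (\<lambda>j. replicate_pmf j (gen_sizes p h 1))))"
  proof (rule has_law_map[OF galton_watson_profiles_subtree[OF gw Suc]])
    fix \<omega>
    assume "\<omega> \<in> space M"
    then have "ordered_tree (\<tau> \<omega>)"
      using measurable_space[of \<tau> M tree_space] gw by (auto simp: galton_watson_def space_tree_space)
    then show "profile (Suc h) [\<tau> \<omega>] = 1 # ?f (?X \<omega>)"
      by (simp add: profile_Suc profile_eq_foldr[of h "map _ _"] o_def del: replicate.simps)
  qed
  also have "map_pmf (\<lambda>xss. 1 # ?f xss) (bind_pmf p (\<lambda>j. replicate_pmf j (gen_sizes p h 1)))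
      = gen_sizes p (Suc h) 1"
    unfolding One_nat_def gen_sizes.simps(2) total_offspring_1 map_bind_pmf
    by (subst (2) gen_sizes_eq_replicate) (simp add: pmf.map_comp o_def)
  finally show ?case .
qed

lemma galton_watson_forest_profile:
  assumes gwf: "galton_watson_forest N p k \<sigma>" and k: "k \<ge> 1"
  shows "has_law N (\<lambda>\<omega>. profile h (forest k \<sigma> \<omega>)) (gen_sizes p h k)"
proof -
  let ?f = "\<lambda>xss. foldr (map2 (+)) xss (replicate (Suc h) 0)"
  let ?X = "\<lambda>\<omega>. map (\<lambda>i. profile h [\<sigma> i \<omega>]) [0..<k]"
  let ?\<nu> = "gen_sizes p h 1"
  interpret prob_space N
    using gwf by (simp add: galton_watson_forest_def)
  have gw: "galton_watson N p (\<sigma> i)" if "i < k" for i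
    using gwf that by (simp add: galton_watson_forest_def)
  have \<sigma>: "\<sigma> i \<in> measurable N tree_space" if "i < k" for i
    using gw[OF that] by (simp add: galton_watson_def)
  have "has_law N ?X (replicate_pmf k ?\<nu>)"
  proof (rule has_lawI)
    fix xs
    define A where "A i = {t \<in> space tree_space. profile h [t] = xs ! i}" for i
    have A: "A i \<in> sets tree_space" for i
      using pred_profile by (simp add: A_def pred_def)
    have \<sigma>A: "\<sigma> i -` A i \<inter> space N = {\<omega> \<in> space N. profile h [\<sigma> i \<omega>] = xs ! i}" if "i < k" for i
      using measurable_space[OF \<sigma>[OF that]] by (auto simp: A_def)
    have prob: "prob (\<sigma> i -` A i \<inter> space N) = pmf ?\<nu> (xs ! i)" if "i < k" for i
      unfolding \<sigma>A[OF that] by (rule has_law_pmf[OF galton_watson_profile[OF gw[OF that]]])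
    have E: "{\<omega> \<in> space N. ?X \<omega> = xs} = (\<Inter>i\<in>{..<k}. \<sigma> i -` A i \<inter> space N)" if "length xs = k"
    proof -
      have "(\<Inter>i\<in>{..<k}. \<sigma> i -` A i \<inter> space N) =
          (\<Inter>i\<in>{..<k}. {\<omega> \<in> space N. profile h [\<sigma> i \<omega>] = xs ! i})"
        using \<sigma>A by auto
      also have "\<dots> = {\<omega> \<in> space N. \<forall>i<k. profile h [\<sigma> i \<omega>] = xs ! i}"
        using k by (auto simp: Suc_le_eq)
      also have "\<dots> = {\<omega> \<in> space N. ?X \<omega> = xs}"
        using that by (auto simp: list_eq_iff_nth_eq[of "map _ _"])
      finally show ?thesis ..
    qed
    have E0: "{\<omega> \<in> space N. ?X \<omega> = xs} = {}" if "length xs \<noteq> k"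
      using that by auto
    show "{\<omega> \<in> space N. ?X \<omega> = xs} \<in> sets N"
    proof (cases "length xs = k")
      case True
      then show ?thesis
        unfolding E[OF True] using k A by (intro sets.finite_INT measurable_sets[OF \<sigma>]) (auto simp: lessThan_empty_iff)
    qed (simp add: E0)
    show "prob {\<omega> \<in> space N. ?X \<omega> = xs} = pmf (replicate_pmf k ?\<nu>) xs"
    proof (cases "length xs = k")
      case True
      have "prob (\<Inter>i\<in>{..<k}. \<sigma> i -` A i \<inter> space N) = (\<Prod>i\<in>{..<k}. prob (\<sigma> i -` A i \<inter> space N))"
        using gwf k A by (intro indep_varsD_finite[where M' = "\<lambda>_. tree_space"])
          (simp_all add: galton_watson_forest_def lessThan_empty_iff)
      then show ?thesis
        unfolding E[OF True] using True prob by (simp add: pmf_replicate_pmf)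
    qed (simp add: E0 pmf_replicate_pmf)
  qed (rule prob_space_axioms)
  then have "has_law N (\<lambda>\<omega>. profile h (forest k \<sigma> \<omega>)) (map_pmf ?f (replicate_pmf k ?\<nu>))"
    by (rule has_law_map, subst profile_eq_foldr) (simp add: forest_def o_def del: replicate.simps)
  then show ?thesis
    by (subst gen_sizes_eq_replicate)
qed

section \<open>The width of Galton--Watson forests\<close>

lemma width_le_iff: "width ts \<le> enat n \<longleftrightarrow> (\<forall>h. Y_forest h ts \<le> n)"
  by (simp add: width_def SUP_le_iff)

lemma prob_width_le:
  assumes M: "prob_space M" and law: "\<And>h. has_law M (\<lambda>\<omega>. profile h (T \<omega>)) (gen_sizes p h K)"
  shows "{\<omega> \<in> space M. width (T \<omega>) \<le> enat n} \<in> sets M"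
    "\<P>(\<omega> in M. width (T \<omega>) \<le> enat n) = width_le_prob p n K"
proof -
  interpret prob_space M by fact
  define A where "A h = {\<omega> \<in> space M. profile h (T \<omega>) \<in> {x. \<forall>y\<in>set x. y \<le> n}}" for h
  have A: "A h = {\<omega> \<in> space M. \<forall>l\<le>h. Y_forest l (T \<omega>) \<le> n}" for h
    by (auto simp: A_def profile_def less_Suc_eq_le simp del: upt_Suc)
  have sets: "A h \<in> sets M" and prob: "prob (A h) = max_le_prob p n h K" for h
    using law[of h] unfolding has_law_def A_def max_le_prob_def by blast+
  have eq: "{\<omega> \<in> space M. width (T \<omega>) \<le> enat n} = (\<Inter>h. A h)"
    unfolding A width_le_iff by blast
  show "{\<omega> \<in> space M. width (T \<omega>) \<le> enat n} \<in> sets M"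
    unfolding eq using sets by auto
  have "decseq A"
    unfolding decseq_def A by auto
  then have "(\<lambda>h. prob (A h)) \<longlonglongrightarrow> prob (\<Inter>h. A h)"
    using sets by (intro finite_Lim_measure_decseq image_subsetI)
  then show "\<P>(\<omega> in M. width (T \<omega>) \<le> enat n) = width_le_prob p n K"
    unfolding eq prob using tendsto_width_le_prob LIMSEQ_unique by blast
qed

lemma prob_width_gt_eq:
  assumes M: "prob_space M" and law: "\<And>h. has_law M (\<lambda>\<omega>. profile h (T \<omega>)) (gen_sizes p h K)"
  shows "\<P>(\<omega> in M. width (T \<omega>) > enat n) = 1 - width_le_prob p n K"
    "n \<ge> 1 \<Longrightarrow> \<P>(\<omega> in M. width (T \<omega>) = enat n) = width_eq_prob p n K"
proof -
  interpret prob_space M by fact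
  note w = prob_width_le[OF M law]
  have "{\<omega> \<in> space M. width (T \<omega>) > enat n} = space M - {\<omega> \<in> space M. width (T \<omega>) \<le> enat n}"
    by auto
  then show "\<P>(\<omega> in M. width (T \<omega>) > enat n) = 1 - width_le_prob p n K"
    using prob_compl[OF w(1)] w(2) by simp
  assume n: "n \<ge> 1"
  have "{\<omega> \<in> space M. width (T \<omega>) = enat n} =
      {\<omega> \<in> space M. width (T \<omega>) \<le> enat n} - {\<omega> \<in> space M. width (T \<omega>) \<le> enat (n - 1)}"
  proof -
    have "x = enat n \<longleftrightarrow> x \<le> enat n \<and> \<not> x \<le> enat (n - 1)" for x
      using n by (cases x) auto
    then show ?thesis by auto
  qed
  moreover have "{\<omega> \<in> space M. width (T \<omega>) \<le> enat (n - 1)} \<subseteq> {\<omega> \<in> space M. width (T \<omega>) \<le> enat n}"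
    using order_trans[of _ "enat (n - 1)" "enat n"] by auto
  ultimately show "\<P>(\<omega> in M. width (T \<omega>) = enat n) = width_eq_prob p n K"
    using finite_measure_Diff[OF w(1) w(1)] w(2) by (simp add: width_eq_prob_def)
qed

theorem proposition2p8:
  fixes p :: "nat pmf"
    and M :: "'a measure" and \<tau> :: "'a \<Rightarrow> tree"
    and N :: "'b measure" and \<sigma> :: "nat \<Rightarrow> 'b \<Rightarrow> tree"
    and k :: nat
  assumes "critical p"
    and "galton_watson M p \<tau>"
    and "k \<ge> 1"
    and "galton_watson_forest N p k \<sigma>"
  shows "((\<lambda>n. \<P>(\<omega> in N. width (forest k \<sigma> \<omega>) > enat n) / \<P>(\<omega> in M. width [\<tau> \<omega>] > enat n))
            \<longlonglongrightarrow> real k) \<and>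
         (bdd_above (set_pmf p) \<longrightarrow>
           infinite {n. \<P>(\<omega> in M. width [\<tau> \<omega>] = enat n) > 0} \<and>
           ((\<lambda>n. \<P>(\<omega> in N. width (forest k \<sigma> \<omega>) = enat n) / \<P>(\<omega> in M. width [\<tau> \<omega>] = enat n))
              \<longlongrightarrow> real k)
             (inf sequentially (principal {n. \<P>(\<omega> in M. width [\<tau> \<omega>] = enat n) > 0})))"
proof -
  have M: "prob_space M" and N: "prob_space N"
    using assms(2,4) unfolding galton_watson_def[of M] galton_watson_forest_def by blast+
  note tree = prob_width_gt_eq[where T = "\<lambda>\<omega>. [\<tau> \<omega>]" and K = 1,
      OF M galton_watson_profile[OF assms(2)]]
  note trees = prob_width_gt_eq[where T = "forest k \<sigma>" and K = k,
      OF N galton_watson_forest_profile[OF assms(4,3)]]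
  \<comment> \<open>The identification with the model requires \<open>n \<ge> 1\<close>, so \<open>S\<close> and \<open>S'\<close> may differ at 0.\<close>
  define S where "S = {n. \<P>(\<omega> in M. width [\<tau> \<omega>] = enat n) > 0}"
  define S' where "S' = {n. width_eq_prob p n 1 > 0}"
  have S: "n \<in> S \<longleftrightarrow> n \<in> S'" if "n \<ge> 1" for n
    using tree(2)[OF that] by (simp add: S_def S'_def)
  have "S' \<subseteq> insert 0 S"
    using S by (metis One_nat_def Suc_leI insert_iff neq0_conv subsetI)
  then have inf: "infinite S"
    using width_eq_prob_infinite[OF assms(1)] finite_subset[of S' "insert 0 S"]
    unfolding S'_def by (metis finite.insertI)
  have eq: "((\<lambda>n. \<P>(\<omega> in N. width (forest k \<sigma> \<omega>) = enat n) / \<P>(\<omega> in M. width [\<tau> \<omega>] = enat n))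
      \<longlongrightarrow> real k) (inf sequentially (principal S))" if "bdd_above (set_pmf p)"
  proof (rule Lim_transform_eventually)
    have "inf sequentially (principal S) = inf sequentially (principal S')"
    proof (rule filter_eq_iff[THEN iffD2], intro allI)
      fix P
      show "eventually P (inf sequentially (principal S)) \<longleftrightarrow> eventually P (inf sequentially (principal S'))"
        unfolding eventually_inf_principal
        by (rule eventually_cong[OF eventually_ge_at_top[of 1]]) (simp add: S)
    qed
    then show "((\<lambda>n. width_eq_prob p n k / width_eq_prob p n 1) \<longlongrightarrow> real k)
        (inf sequentially (principal S))"
      using width_eq_ratio[OF assms(1) that, of k] by (simp only: S'_def)
    show "\<forall>\<^sub>F n in inf sequentially (principal S). width_eq_prob p n k / width_eq_prob p n 1 =
        \<P>(\<omega> in N. width (forest k \<sigma> \<omega>) = enat n) / \<P>(\<omega> in M. width [\<tau> \<omega>] = enat n)"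
      unfolding eventually_inf_principal using eventually_ge_at_top[of 1]
    proof eventually_elim
      case (elim n)
      show ?case
        unfolding tree(2)[OF elim] trees(2)[OF elim] by blast
    qed
  qed
  have tail: "(\<lambda>n. \<P>(\<omega> in N. width (forest k \<sigma> \<omega>) > enat n) / \<P>(\<omega> in M. width [\<tau> \<omega>] > enat n))
      \<longlonglongrightarrow> real k"
    unfolding tree(1) trees(1) by (rule width_tail_ratio[OF assms(1)])
  show ?thesis
    using inf eq tail unfolding S_def by blast
qed

end
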